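(* Let $(G,\mathcal{P},\mathcal{L})$ be a point-line framework in $\mathbb{R}^2$ with spatial symmetry group $\mathcal{G}$. Then its rigidity matrix satisfies $$R(G,\mathcal{P},\mathcal{L})=\rho_e(g^{-1})\,R(G,\mathcal{P},\mathcal{L})\,\hat\rho_v(g),\qquad g\in\mathcal{G},$$ and, as an equality of character lists (i.e. of traces at each $g\in\mathcal{G}$), $$[\rho_{mech}]-[\rho_{st}]=[\rho_n]\cdot[\rho_{sp}]-[\rho_e]-[\rho_{rig}],$$ where $\cdot$ is the entrywise product. In particular, if the framework is isostatic and has a proper reflection symmetry, with graph automorphism $\sigma\neq\mathrm{id}$, then $$b_{pp}+b_{ll}+b_{pl}-1=0,$$ where $b_{pp}$, $b_{ll}$ and $b_{pl}$ are the numbers of point-point edges, line-line edges and point-line edges which are unchanged by the reflection.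
   Context: A point-line framework $(G,\mathcal{P},\mathcal{L})$ in $\mathbb{R}^2$ consists of a finite set $\mathcal{P}=\{p_1,\dots,p_n\}$ of points, a finite set $\mathcal{L}=\{L_1,\dots,L_r\}$ of straight lines, and a finite connected simple graph $G=(V,E)$ with $V=V_p\cup V_l$, where $V_p$ labels the points and $V_l$ labels the lines; correspondingly $E=E_{pp}\cup E_{pl}\cup E_{ll}$ (point-point, point-line, line-line edges). It is assumed that there is at least one point and at least one line, that no line passes through the origin, and that the origin is the centre of symmetry (so every spatial symmetry is effected by a linear isometry). A point $p_i$ has coordinates $(x_i,y_i)$; a line $L_j$ is parametrised by the coordinates $(x_j',y_j')\neq 0$ of its closest point to the origin. Each edge $e$ has a generalised distance function $f_e$ of these variables: Euclidean distance for $e\in E_{pp}$; the nonnegative point-line distance for $e\in E_{pl}$; the angle in $[0,\pi/2]$ between the lines for $e\in E_{ll}$. Let $\mathcal{H}_v=\mathbb{R}^{n+r}\otimes\mathbb{R}^2$ (one copy of $\mathbb{R}^2$ for each point and each line) and $\mathcal{H}_e=\mathbb{R}^{|E|}$, with standard inner products. The rigidity matrix $R(G,\mathcal{P},\mathcal{L}):\mathcal{H}_v\to\mathcal{H}_e$ is the Jacobian matrix of the map $(f_e)_{e\in E}$ evaluated at the coordinates of the framework (the $f_e$ being assumed differentiable there, so that it is defined). The spatial symmetry group $\mathcal{G}$ is the group of $g=(\sigma,T)$ where $T$ is a linear isometry of $\mathbb{R}^2$ and $\sigma$ is an automorphism of $G$ preserving $V_p$ and $V_l$, such that $T$ maps the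 object (point or line) labelled by $v$ to the object labelled by $\sigma(v)$ for all $v\in V$. For such $g$: $\rho_{sp}(g)=T\in O(2)$; $\rho_n(g)$ is the permutation matrix of $\sigma$ on $\mathbb{R}^{n+r}$ (basis vector of $v$ goes to that of $\sigma(v)$); $\rho_e(g)$ is the permutation matrix on $\mathcal{H}_e$ (basis vector of $f$ goes to that of $\sigma(f)$); and $\hat\rho_v=\rho_n\otimes\rho_{sp}$. $\mathcal{H}_{st}=\operatorname{coker}R(G,\mathcal{P},\mathcal{L})$, i.e. the kernel of the transpose. $\mathcal{H}_{rig}\subseteq\ker R(G,\mathcal{P},\mathcal{L})$ is the three-dimensional space of trivial flexes: the velocity vectors in $\mathcal{H}_v$ of the point and line coordinates induced by infinitesimal rigid motions (translations and rotations) of $\mathbb{R}^2$. $\mathcal{H}_{mech}$ is the orthogonal complement of $\mathcal{H}_{rig}$ in $\ker R(G,\mathcal{P},\mathcal{L})$. $\rho_{rig},\rho_{mech}$ are the restrictions of $\hat\rho_v$ to $\mathcal{H}_{rig},\mathcal{H}_{mech}$, and $\rho_{st}$ is the restriction of $\rho_e$ to $\mathcal{H}_{st}$ (these subspaces being invariant). The framework is isostatic if $\mathcal{H}_{mech}=\{0\}$ and $\mathcal{H}_{st}=\{0\}$. A reflection symmetry is an element $(\sigma,T)\in\mathcal{G}$ with $T$ a reflection in a line through the origin; an edge is unchanged by it if $\sigma(e)=e$. *)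

theory Defs
  imports "HOL-Analysis.Analysis" "HOL-Algebra.Group"
begin

text \<open>
  The vertex set is the type \<^typ>\<open>'p + 'l\<close>: \<^term>\<open>range Inl\<close> labels the points and
  \<^term>\<open>range Inr\<close> labels the lines. Since \<^typ>\<open>'p\<close> and \<^typ>\<open>'l\<close> are nonempty finite types,
  there is at least one point and at least one line. The edges are enumerated by a finite type
  \<^typ>\<open>'e\<close>, where \<^term>\<open>ends e\<close> is the two-element vertex set which is the edge with index
  \<^term>\<open>e\<close>; thus the edge set is \<^term>\<open>range ends\<close>.
\<close>

definition simple_graph :: "('e::finite \<Rightarrow> 'v::finite set) \<Rightarrow> bool" where
  "simple_graph ends \<longleftrightarrow> inj ends \<and> (\<forall>e. card (ends e) = 2)"

definition connected_graph :: "('e::finite \<Rightarrow> 'v::finite set) \<Rightarrow> bool" where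
  "connected_graph ends \<longleftrightarrow> (\<forall>u v. (u, v) \<in> {(a, b). {a, b} \<in> range ends}\<^sup>*)"

definition pp_edges :: "('e \<Rightarrow> ('p + 'l) set) \<Rightarrow> 'e set" where
  "pp_edges ends = {e. ends e \<subseteq> range Inl}"

definition ll_edges :: "('e \<Rightarrow> ('p + 'l) set) \<Rightarrow> 'e set" where
  "ll_edges ends = {e. ends e \<subseteq> range Inr}"

definition pl_edges :: "('e \<Rightarrow> ('p + 'l) set) \<Rightarrow> 'e set" where
  "pl_edges ends = {e. \<exists>i j. ends e = {Inl i, Inr j}}"

definition straight_line :: "(real^2) set \<Rightarrow> bool" where
  "straight_line X \<longleftrightarrow> affine X \<and> aff_dim X = 1"


subsection \<open>Coordinates and generalised distances\<close>

text \<open>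
  \<open>\<H>\<^sub>v = \<real>\<^sup>n\<^sup>+\<^sup>r \<otimes> \<real>\<^sup>2\<close> is \<open>real^(('p + 'l) \<times> 2)\<close>: its standard basis is indexed by pairs of a vertex and
  an index of a coordinate. \<open>\<H>\<^sub>e\<close> is \<open>real^'e\<close>.
\<close>

definition coords ::
    "('p::finite \<Rightarrow> real^2) \<Rightarrow> ('l::finite \<Rightarrow> (real^2) set) \<Rightarrow> real^(('p + 'l) \<times> 2)" where
  "coords P L =
     (\<chi> vi. (case fst vi of Inl i \<Rightarrow> P i | Inr j \<Rightarrow> closest_point (L j) 0) $ snd vi)"

definition block :: "real^('v::finite \<times> 2) \<Rightarrow> 'v \<Rightarrow> real^2" where
  "block x v = (\<chi> i. x $ (v, i))"

text \<open>For \<^term>\<open>a \<noteq> 0\<close>, the line whose closest point to the origin is \<^term>\<open>a\<close>.\<close>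

definition line_at :: "real^2 \<Rightarrow> (real^2) set" where
  "line_at a = {z. (z - a) \<bullet> a = 0}"

definition line_dir :: "real^2 \<Rightarrow> real^2" where
  "line_dir a = vector [- a $ 2, a $ 1]"

definition line_angle :: "real^2 \<Rightarrow> real^2 \<Rightarrow> real" where
  "line_angle a b =
     arccos (\<bar>line_dir a \<bullet> line_dir b\<bar> / (norm (line_dir a) * norm (line_dir b)))"

fun gen_dist :: "real^(('p::finite + 'l::finite) \<times> 2) \<Rightarrow> 'p + 'l \<Rightarrow> 'p + 'l \<Rightarrow> real" where
  "gen_dist x (Inl i) (Inl j) = dist (block x (Inl i)) (block x (Inl j))"
| "gen_dist x (Inl i) (Inr j) = infdist (block x (Inl i)) (line_at (block x (Inr j)))"
| "gen_dist x (Inr j) (Inl i) = infdist (block x (Inl i)) (line_at (block x (Inr j)))"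
| "gen_dist x (Inr i) (Inr j) = line_angle (block x (Inr i)) (block x (Inr j))"

definition edge_dist ::
    "('e::finite \<Rightarrow> ('p::finite + 'l::finite) set) \<Rightarrow> 'e \<Rightarrow> real^(('p + 'l) \<times> 2) \<Rightarrow> real" where
  "edge_dist ends e x = (THE d. \<exists>u v. ends e = {u, v} \<and> d = gen_dist x u v)"

lemma closest_point_line_at: "closest_point (line_at a) 0 = a"
proof (rule closest_point_unique[symmetric])
  have eq: "line_at a = {z. a \<bullet> z = a \<bullet> a}"
    by (auto simp: line_at_def inner_diff inner_commute)
  show "convex (line_at a)" "closed (line_at a)"
    unfolding eq by (rule convex_hyperplane closed_hyperplane)+
  show "a \<in> line_at a"
    by (simp add: line_at_def)
  show "\<forall>z\<in>line_at a. dist 0 a \<le> dist 0 z"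
  proof
    fix z assume "z \<in> line_at a"
    then have "norm a * norm a \<le> norm a * norm z"
      using Cauchy_Schwarz_ineq2[of a z] unfolding eq
      by (simp add: power2_norm_eq_inner[symmetric] power2_eq_square)
    then show "dist 0 a \<le> dist 0 z"
      by (cases "a = 0") auto
  qed
qed

lemma gen_dist_commute: "gen_dist x u v = gen_dist x v u"
  by (cases u; cases v) (simp_all add: dist_commute line_angle_def inner_commute mult.commute)

lemma edge_dist_eq: "ends e = {u, v} \<Longrightarrow> edge_dist ends e x = gen_dist x u v"
  unfolding edge_dist_def
  by (rule the_equality) (auto simp: doubleton_eq_iff gen_dist_commute)


subsection \<open>Frameworks, the rigidity matrix and its spaces\<close>

definition point_line_framework ::
    "('e::finite \<Rightarrow> ('p::finite + 'l::finite) set) \<Rightarrow> ('p \<Rightarrow> real^2) \<Rightarrow> ('l \<Rightarrow> (real^2) set) \<Rightarrow> bool" where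
  "point_line_framework ends P L \<longleftrightarrow>
     simple_graph ends \<and> connected_graph ends \<and>
     (\<forall>j. straight_line (L j) \<and> 0 \<notin> L j) \<and>
     (\<forall>e. edge_dist ends e differentiable at (coords P L))"

definition rigidity_matrix ::
    "('e::finite \<Rightarrow> ('p::finite + 'l::finite) set) \<Rightarrow> ('p \<Rightarrow> real^2) \<Rightarrow> ('l \<Rightarrow> (real^2) set)
      \<Rightarrow> real^(('p + 'l) \<times> 2)^'e" where
  "rigidity_matrix ends P L = jacobian (\<lambda>x. \<chi> e. edge_dist ends e x) (at (coords P L))"

definition rotation :: "real \<Rightarrow> real^2^2" where
  "rotation \<theta> = vector [vector [cos \<theta>, - sin \<theta>], vector [sin \<theta>, cos \<theta>]]"

definition rigid_motion :: "real \<Rightarrow> real^2 \<Rightarrow> real^2 \<Rightarrow> real^2" where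
  "rigid_motion \<theta> \<tau> z = rotation \<theta> *v z + \<tau>"

text \<open>
  The velocities at time 0 of the coordinates of the framework when its points and lines are
  moved by the rigid motions \<open>z \<mapsto> rotation (t\<omega>) z + t\<tau>\<close>, for arbitrary \<open>\<omega>\<close> and \<open>\<tau>\<close>.
\<close>

definition H_rig ::
    "('p::finite \<Rightarrow> real^2) \<Rightarrow> ('l::finite \<Rightarrow> (real^2) set) \<Rightarrow> (real^(('p + 'l) \<times> 2)) set" where
  "H_rig P L = {w. \<exists>\<omega> \<tau>.
     ((\<lambda>t. coords (\<lambda>i. rigid_motion (t * \<omega>) (t *\<^sub>R \<tau>) (P i))
                  (\<lambda>j. rigid_motion (t * \<omega>) (t *\<^sub>R \<tau>) ` L j))
       has_vector_derivative w) (at 0)}"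

definition H_mech ::
    "('e::finite \<Rightarrow> ('p::finite + 'l::finite) set) \<Rightarrow> ('p \<Rightarrow> real^2) \<Rightarrow> ('l \<Rightarrow> (real^2) set)
      \<Rightarrow> (real^(('p + 'l) \<times> 2)) set" where
  "H_mech ends P L = {w. rigidity_matrix ends P L *v w = 0} \<inter> orthogonal_comp (H_rig P L)"

definition H_st ::
    "('e::finite \<Rightarrow> ('p::finite + 'l::finite) set) \<Rightarrow> ('p \<Rightarrow> real^2) \<Rightarrow> ('l \<Rightarrow> (real^2) set)
      \<Rightarrow> (real^'e) set" where
  "H_st ends P L = {s. transpose (rigidity_matrix ends P L) *v s = 0}"

definition isostatic ::
    "('e::finite \<Rightarrow> ('p::finite + 'l::finite) set) \<Rightarrow> ('p \<Rightarrow> real^2) \<Rightarrow> ('l \<Rightarrow> (real^2) set) \<Rightarrow> bool" where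
  "isostatic ends P L \<longleftrightarrow> H_mech ends P L = {0} \<and> H_st ends P L = {0}"


subsection \<open>The spatial symmetry group and its representations\<close>

definition located :: "('p \<Rightarrow> real^2) \<Rightarrow> ('l \<Rightarrow> (real^2) set) \<Rightarrow> 'p + 'l \<Rightarrow> (real^2) set" where
  "located P L v = (case v of Inl i \<Rightarrow> {P i} | Inr j \<Rightarrow> L j)"

definition graph_automorphism ::
    "('e::finite \<Rightarrow> ('p::finite + 'l::finite) set) \<Rightarrow> ('p + 'l \<Rightarrow> 'p + 'l) \<Rightarrow> bool" where
  "graph_automorphism ends \<sigma> \<longleftrightarrow>
     bij \<sigma> \<and> (\<forall>u v. {\<sigma> u, \<sigma> v} \<in> range ends \<longleftrightarrow> {u, v} \<in> range ends) \<and>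
     \<sigma> ` range Inl = range Inl \<and> \<sigma> ` range Inr = range Inr"

definition spatial_group ::
    "('e::finite \<Rightarrow> ('p::finite + 'l::finite) set) \<Rightarrow> ('p \<Rightarrow> real^2) \<Rightarrow> ('l \<Rightarrow> (real^2) set)
      \<Rightarrow> (('p + 'l \<Rightarrow> 'p + 'l) \<times> (real^2^2)) monoid" where
  "spatial_group ends P L =
     \<lparr> carrier = {(\<sigma>, T). graph_automorphism ends \<sigma> \<and> orthogonal_matrix T \<and>
                          (\<forall>v. (\<lambda>z. T *v z) ` located P L v = located P L (\<sigma> v))},
       mult = (\<lambda>g h. (fst g \<circ> fst h, snd g ** snd h)),
       one = (id, mat 1) \<rparr>"

definition rho_sp :: "('v \<Rightarrow> 'v) \<times> (real^2^2) \<Rightarrow> real^2^2" where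
  "rho_sp g = snd g"

definition rho_n :: "('v::finite \<Rightarrow> 'v) \<times> (real^2^2) \<Rightarrow> real^'v^'v" where
  "rho_n g = (\<chi> u v. if u = fst g v then 1 else 0)"

definition rho_e ::
    "('e::finite \<Rightarrow> 'v::finite set) \<Rightarrow> ('v \<Rightarrow> 'v) \<times> (real^2^2) \<Rightarrow> real^'e^'e" where
  "rho_e ends g = (\<chi> e f. if ends e = fst g ` ends f then 1 else 0)"

definition kronecker ::
    "real^'a::finite^'b::finite \<Rightarrow> real^'c::finite^'d::finite \<Rightarrow> real^('a \<times> 'c)^('b \<times> 'd)" where
  "kronecker A B = (\<chi> bd ac. A $ fst bd $ fst ac * B $ snd bd $ snd ac)"

definition rho_v :: "('v::finite \<Rightarrow> 'v) \<times> (real^2^2) \<Rightarrow> real^('v \<times> 2)^('v \<times> 2)" where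
  "rho_v g = kronecker (rho_n g) (rho_sp g)"

text \<open>
  The trace of the restriction of a linear map to an invariant subspace; the lemma
  \<open>trace_on_eq\<close> below shows that the choice of the basis is immaterial.
\<close>

definition trace_on :: "'a::euclidean_space set \<Rightarrow> ('a \<Rightarrow> 'a) \<Rightarrow> real" where
  "trace_on S f =
     (let B = (SOME B. independent B \<and> span B = S) in \<Sum>b\<in>B. representation B (f b) b)"

definition chi_mech where
  "chi_mech ends P L g = trace_on (H_mech ends P L) (\<lambda>w. rho_v g *v w)"

definition chi_rig where
  "chi_rig P L g = trace_on (H_rig P L) (\<lambda>w. rho_v g *v w)"

definition chi_st where
  "chi_st ends P L g = trace_on (H_st ends P L) (\<lambda>s. rho_e ends g *v s)"

definition is_reflection :: "real^2^2 \<Rightarrow> bool" where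
  "is_reflection T \<longleftrightarrow> (\<exists>n. n \<noteq> 0 \<and> (\<forall>z. T *v z = z - (2 * (z \<bullet> n) / (n \<bullet> n)) *\<^sub>R n))"

definition unchanged ::
    "('e::finite \<Rightarrow> 'v::finite set) \<Rightarrow> ('v \<Rightarrow> 'v) \<times> (real^2^2) \<Rightarrow> 'e set" where
  "unchanged ends g = {e. fst g ` ends e = ends e}"

lemma graph_automorphism_comp:
  assumes "graph_automorphism ends \<sigma>" "graph_automorphism ends \<tau>"
  shows "graph_automorphism ends (\<sigma> \<circ> \<tau>)"
  unfolding graph_automorphism_def
proof (intro conjI allI)
  show "bij (\<sigma> \<circ> \<tau>)"
    using assms by (simp add: graph_automorphism_def bij_comp)
  show "{(\<sigma> \<circ> \<tau>) u, (\<sigma> \<circ> \<tau>) v} \<in> range ends \<longleftrightarrow> {u, v} \<in> range ends" for u v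
    using assms by (simp only: graph_automorphism_def o_apply)
  show "(\<sigma> \<circ> \<tau>) ` range Inl = range Inl" "(\<sigma> \<circ> \<tau>) ` range Inr = range Inr"
    using assms by (simp_all only: graph_automorphism_def image_comp[symmetric])
qed

lemma graph_automorphism_inv:
  assumes "graph_automorphism ends \<sigma>"
  shows "graph_automorphism ends (inv_into UNIV \<sigma>)"
  unfolding graph_automorphism_def
proof (intro conjI allI)
  have b: "bij \<sigma>" using assms by (simp add: graph_automorphism_def)
  then show "bij (inv_into UNIV \<sigma>)" by (rule bij_imp_bij_inv)
  have "{\<sigma> (inv_into UNIV \<sigma> u), \<sigma> (inv_into UNIV \<sigma> v)} \<in> range ends \<longleftrightarrow> {inv_into UNIV \<sigma> u, inv_into UNIV \<sigma> v} \<in> range ends" for u v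
    using assms by (simp only: graph_automorphism_def)
  then show "{inv_into UNIV \<sigma> u, inv_into UNIV \<sigma> v} \<in> range ends \<longleftrightarrow> {u, v} \<in> range ends" for u v
    using b by (simp add: bij_is_surj surj_f_inv_f)
  have "inv_into UNIV \<sigma> ` X = X" if "\<sigma> ` X = X" for X
    using image_inv_f_f[OF bij_is_inj[OF b], of X] that by simp
  then show "inv_into UNIV \<sigma> ` range Inl = range Inl" "inv_into UNIV \<sigma> ` range Inr = range Inr"
    using assms by (simp_all only: graph_automorphism_def)
qed

lemma group_spatial_group: "group (spatial_group ends P L)"
proof (rule groupI)
  let ?G = "spatial_group ends P L"
  show "\<one>\<^bsub>?G\<^esub> \<in> carrier ?G"
    by (simp add: spatial_group_def graph_automorphism_def orthogonal_matrix_def)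
  show "g \<otimes>\<^bsub>?G\<^esub> h \<in> carrier ?G" if "g \<in> carrier ?G" "h \<in> carrier ?G" for g h
  proof -
    have "(\<lambda>z. (snd g ** snd h) *v z) ` X = (\<lambda>z. snd g *v z) ` (\<lambda>z. snd h *v z) ` X" for X
      by (simp add: image_image matrix_vector_mul_assoc)
    moreover have "graph_automorphism ends (fst g \<circ> fst h)"
      using that by (intro graph_automorphism_comp) (auto simp: spatial_group_def)
    ultimately show ?thesis
      using that by (simp add: spatial_group_def orthogonal_matrix_mul split_beta)
  qed
  show "(g \<otimes>\<^bsub>?G\<^esub> h) \<otimes>\<^bsub>?G\<^esub> k = g \<otimes>\<^bsub>?G\<^esub> (h \<otimes>\<^bsub>?G\<^esub> k)" for g h k
    by (simp add: spatial_group_def comp_assoc matrix_mul_assoc)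
  show "\<one>\<^bsub>?G\<^esub> \<otimes>\<^bsub>?G\<^esub> g = g" for g
    by (simp add: spatial_group_def)
  show "\<exists>h\<in>carrier ?G. h \<otimes>\<^bsub>?G\<^esub> g = \<one>\<^bsub>?G\<^esub>" if g: "g \<in> carrier ?G" for g
  proof -
    obtain \<sigma> T where [simp]: "g = (\<sigma>, T)" by force
    have a: "graph_automorphism ends \<sigma>" and o: "orthogonal_matrix T"
      and m: "\<And>v. (\<lambda>z. T *v z) ` located P L v = located P L (\<sigma> v)"
      using g by (auto simp: spatial_group_def)
    have b: "bij \<sigma>" using a by (simp add: graph_automorphism_def)
    then have s: "\<And>v. \<sigma> (inv_into UNIV \<sigma> v) = v" "\<And>v. inv_into UNIV \<sigma> (\<sigma> v) = v"
      by (auto simp: bij_is_surj surj_f_inv_f bij_is_inj)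
    have 1: "graph_automorphism ends (inv_into UNIV \<sigma>)"
      using a by (rule graph_automorphism_inv)
    have "(\<lambda>z. transpose T *v z) ` located P L v = located P L (inv_into UNIV \<sigma> v)" for v
    proof -
      have "(\<lambda>z. transpose T *v z) ` located P L v
            = (\<lambda>z. transpose T *v z) ` (\<lambda>z. T *v z) ` located P L (inv_into UNIV \<sigma> v)"
        by (simp add: m s)
      also have "\<dots> = located P L (inv_into UNIV \<sigma> v)"
        using o by (simp add: image_image matrix_vector_mul_assoc orthogonal_matrix_def
            del: transpose_matrix_vector)
      finally show ?thesis .
    qed
    then have "(inv_into UNIV \<sigma>, transpose T) \<in> carrier ?G"
      using 1 o by (simp add: spatial_group_def orthogonal_matrix_transpose)
    moreover have "(inv_into UNIV \<sigma>, transpose T) \<otimes>\<^bsub>?G\<^esub> g = \<one>\<^bsub>?G\<^esub>"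
      using o b by (simp add: spatial_group_def orthogonal_matrix_def bij_is_inj)
    ultimately show ?thesis by blast
  qed
qed

lemma sum_representation_basis_indep:
  fixes f :: "'a::euclidean_space \<Rightarrow> 'a"
  assumes f: "linear f" "f ` S \<subseteq> S"
    and B: "independent B" "span B = S" and C: "independent C" "span C = S"
  shows "(\<Sum>b\<in>B. representation B (f b) b) = (\<Sum>c\<in>C. representation C (f c) c)"
proof -
  have fin: "finite B" "finite C"
    using B C independent_imp_finite by auto
  have fS: "f x \<in> S" if "x \<in> S" for x using that f by blast
  have inS: "x \<in> S" if "x \<in> B \<or> x \<in> C" for x using that B C span_base by blast
  have expand: "(\<Sum>d\<in>D. representation D x d *\<^sub>R d) = x"
    if "independent D" "span D = S" "x \<in> S" for D x
    using that independent_imp_finite[of D] by (intro real_vector.sum_representation_eq) auto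
  have rep_sum: "representation D (\<Sum>x\<in>A. k x *\<^sub>R h x) d = (\<Sum>x\<in>A. k x * representation D (h x) d)"
    if "independent D" "span D = S" "\<And>x. x \<in> A \<Longrightarrow> h x \<in> S"
    for D A d and k :: "'a \<Rightarrow> real" and h :: "'a \<Rightarrow> 'a"
  proof -
    have "h x \<in> span D" if "x \<in> A" for x
      using that \<open>span D = S\<close> \<open>\<And>x. x \<in> A \<Longrightarrow> h x \<in> S\<close> by simp
    then show ?thesis
      using \<open>independent D\<close>
      by (simp add: real_vector.representation_sum real_vector.representation_scale span_scale)
  qed
  have "(\<Sum>b\<in>B. representation B (f b) b)
        = (\<Sum>b\<in>B. representation B (\<Sum>c\<in>C. representation C b c *\<^sub>R f c) b)"
  proof (rule sum.cong[OF refl])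
    fix b assume "b \<in> B"
    then have "f b = f (\<Sum>c\<in>C. representation C b c *\<^sub>R c)"
      using expand[OF C] inS by simp
    then show "representation B (f b) b
        = representation B (\<Sum>c\<in>C. representation C b c *\<^sub>R f c) b"
      using f(1) by (simp add: linear_sum linear_scale)
  qed
  also have "\<dots> = (\<Sum>b\<in>B. \<Sum>c\<in>C. representation C b c * representation B (f c) b)"
    using rep_sum[OF B] fS inS by (intro sum.cong) auto
  also have "\<dots> = (\<Sum>c\<in>C. \<Sum>b\<in>B. representation B (f c) b * representation C b c)"
    by (subst sum.swap) (simp add: mult.commute)
  also have "\<dots> = (\<Sum>c\<in>C. representation C (\<Sum>b\<in>B. representation B (f c) b *\<^sub>R b) c)"
    using rep_sum[OF C, of B "\<lambda>b. b"] inS by (intro sum.cong) auto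
  also have "\<dots> = (\<Sum>c\<in>C. representation C (f c) c)"
    using expand[OF B] fS inS by (intro sum.cong) auto
  finally show ?thesis .
qed

lemma trace_on_eq:
  assumes "linear f" "f ` S \<subseteq> S" "independent B" "span B = S"
  shows "trace_on S f = (\<Sum>b\<in>B. representation B (f b) b)"
proof -
  have "independent (SOME B. independent B \<and> span B = S) \<and>
        span (SOME B. independent B \<and> span B = S) = S"
    by (rule someI[of _ B]) (use assms in auto)
  then show ?thesis
    unfolding trace_on_def Let_def
    using sum_representation_basis_indep assms by blast
qed

end

theory Submission
  imports Defs
begin

text \<open>
  The argument is representation theory for one linear map. A spatial symmetry \<open>g = (\<sigma>, T)\<close> acts on all
  configurations by \<^term>\<open>rho_v g\<close>: it moves each block by \<open>T\<close> and relabels by \<open>\<sigma>\<close>. Generalised distances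
  do not change under isometries, so applying \<^term>\<open>rho_v g\<close> to a configuration only permutes the list
  of its edge distances, by \<^term>\<open>rho_e ends g\<close> (\<open>edge_dist_rho_v\<close>). The framework itself is fixed by
  \<^term>\<open>rho_v g\<close>. Differentiating there gives \<open>\<rho>\<^sub>e(g) R = R \<rho>\<^sub>v(g)\<close> (\<open>rigidity_matrix_equivariant\<close>), which is
  the first claim.

  For a matrix \<open>R\<close> that intertwines two orthogonal representations, the complement of the kernel and the
  complement of the cokernel are isomorphic representations. Therefore the difference of the traces on
  kernel and cokernel equals the difference of the traces on the whole spaces
  (\<open>trace_ker_minus_coker\<close>). The trace of the Kronecker product is the product of the traces. The
  kernel of \<open>R\<close> is the orthogonal sum of the trivial flexes and the mechanisms, provided that the trivial
  flexes do lie in the kernel: this holds because distances are constant along rigid motions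
  (\<open>rigid_velocity_in_kernel\<close>). Together this is the formula for the characters.

  For the last claim the trivial flexes are parametrised explicitly by an angular velocity and a
  translation vector. The parametrisation is injective, as there is a point and a line off the
  origin, and \<open>g\<close> acts on the parameters by \<open>det T\<close> and \<open>T\<close>. So the character of the trivial flexes is
  \<open>det T + trace T\<close> (\<open>chi_rig_eq\<close>), which is \<open>- 1\<close> for a reflection. For an isostatic framework the
  left-hand side of the character formula vanishes, as does \<open>trace T\<close>. The formula thus reduces to
  \<open>trace \<rho>\<^sub>e(g) = 1\<close>, and the trace of a permutation matrix counts the fixed edges.
\<close>

section \<open>Traces on invariant subspaces\<close>

lemma representation_orthonormal:
  fixes B :: "'a::euclidean_space set"
  assumes B: "pairwise orthogonal B" "\<And>b. b \<in> B \<Longrightarrow> norm b = 1" and x: "x \<in> span B" and b: "b \<in> B"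
  shows "representation B x b = x \<bullet> b"
proof -
  have ind: "independent B"
    using B by (intro pairwise_orthogonal_independent) force+
  then have fin: "finite B"
    by (rule independent_imp_finite)
  have "x \<bullet> b = (\<Sum>c\<in>B. representation B x c *\<^sub>R c) \<bullet> b"
    using real_vector.sum_representation_eq[OF ind x fin] by simp
  also have "\<dots> = (\<Sum>c\<in>B. if c = b then representation B x b else 0)"
    unfolding inner_sum_left using B b
    by (intro sum.cong) (auto simp: pairwise_def orthogonal_def dot_square_norm)
  also have "\<dots> = representation B x b"
    using fin b by simp
  finally show ?thesis by simp
qed

lemma trace_on_orthonormal:
  fixes f :: "'a::euclidean_space \<Rightarrow> 'a"
  assumes f: "linear f" "f ` S \<subseteq> S"
    and B: "pairwise orthogonal B" "\<And>b. b \<in> B \<Longrightarrow> norm b = 1" "span B = S"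
  shows "trace_on S f = (\<Sum>b\<in>B. f b \<bullet> b)"
proof -
  have ind: "independent B"
    using B by (intro pairwise_orthogonal_independent) force+
  have "f b \<in> span B" if "b \<in> B" for b
    using that f(2) B(3) span_base by blast
  then show ?thesis
    unfolding trace_on_eq[OF f ind B(3)]
    using B by (intro sum.cong representation_orthonormal) auto
qed

lemma trace_on_UNIV:
  fixes f :: "'a::euclidean_space \<Rightarrow> 'a"
  assumes "linear f"
  shows "trace_on UNIV f = (\<Sum>b\<in>Basis. f b \<bullet> b)"
  using assms by (intro trace_on_orthonormal)
    (auto simp: pairwise_def orthogonal_def inner_Basis)

lemma trace_on_matrix: "trace_on UNIV ((*v) A) = trace A"
  for A :: "real^'n^'n"
proof -
  have "trace_on UNIV ((*v) A) = (\<Sum>b\<in>(Basis :: (real^'n) set). (A *v b) \<bullet> b)"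
    by (rule trace_on_UNIV) simp
  also have "\<dots> = (\<Sum>i\<in>UNIV. (A *v axis i 1) \<bullet> axis i 1)"
    by (simp add: Basis_vec_def UNION_singleton_eq_range sum.reindex axis_eq_axis inj_on_def)
  also have "\<dots> = trace A"
    by (simp add: trace_def inner_axis matrix_vector_mul_component)
  finally show ?thesis .
qed

text \<open>
  Orthonormal bases of \<open>S\<close> and of its orthogonal complement in \<open>V\<close> together form one of \<open>V\<close>, and with
  respect to it the matrix of \<open>f\<close> is block diagonal.
\<close>

lemma trace_on_orthogonal_split:
  fixes f :: "'a::euclidean_space \<Rightarrow> 'a"
  assumes f: "linear f" and S: "subspace S" "f ` S \<subseteq> S" and V: "subspace V" "S \<subseteq> V"
    and inv: "f ` (V \<inter> S\<^sup>\<bottom>) \<subseteq> V \<inter> S\<^sup>\<bottom>"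
  shows "trace_on V f = trace_on S f + trace_on (V \<inter> S\<^sup>\<bottom>) f"
proof -
  have T: "subspace (V \<inter> S\<^sup>\<bottom>)"
    using V by (simp add: subspace_inter subspace_orthogonal_comp)
  obtain B where B: "B \<subseteq> S" "pairwise orthogonal B" "\<And>x. x \<in> B \<Longrightarrow> norm x = 1" "independent B" "span B = S"
    using orthonormal_basis_subspace[OF S(1)] by metis
  obtain C where C: "C \<subseteq> V \<inter> S\<^sup>\<bottom>" "pairwise orthogonal C" "\<And>x. x \<in> C \<Longrightarrow> norm x = 1" "independent C"
    "span C = V \<inter> S\<^sup>\<bottom>"
    using orthonormal_basis_subspace[OF T] by metis
  have BC: "orthogonal b c" "orthogonal c b" if "b \<in> B" "c \<in> C" for b c
    using that B(1) C(1) unfolding orthogonal_comp_def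
    by (blast intro: orthogonal_commute[THEN iffD1])+
  then have "B \<inter> C = {}"
    using B(3) by (force simp: orthogonal_def dot_square_norm)
  have orth: "pairwise orthogonal (B \<union> C)"
    using B(2) C(2) BC by (auto simp: pairwise_def)
  have decomp: "\<exists>y\<in>S. \<exists>z\<in>V \<inter> S\<^sup>\<bottom>. v = y + z" if "v \<in> V" for v
  proof -
    obtain y z where yz: "y \<in> span S" "\<And>w. w \<in> span S \<Longrightarrow> orthogonal z w" "v = y + z"
      using orthogonal_subspace_decomp_exists[of S v] by metis
    have y: "y \<in> S"
      using yz(1) S(1) by (metis span_eq_iff)
    then have "z \<in> V"
      using yz(3) that V by (metis add_diff_cancel_left' in_mono subspace_diff)
    moreover have "z \<in> S\<^sup>\<bottom>"
      using yz(2) by (auto simp: orthogonal_comp_def orthogonal_commute span_base)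
    ultimately show ?thesis
      using y yz(3) by blast
  qed
  have span: "span (B \<union> C) = V"
  proof
    show "span (B \<union> C) \<subseteq> V"
      using B(1) C(1) V by (intro span_minimal) auto
    show "V \<subseteq> span (B \<union> C)"
      using decomp unfolding span_Un B(5) C(5) by blast
  qed
  have fV: "f ` V \<subseteq> V"
  proof clarify
    fix v assume "v \<in> V"
    then obtain y z where "y \<in> S" "z \<in> V \<inter> S\<^sup>\<bottom>" "v = y + z"
      using decomp by blast
    then show "f v \<in> V"
      using S(2) V inv by (auto simp: linear_add[OF f] image_subset_iff intro!: subspace_add)
  qed
  have "trace_on V f = (\<Sum>b\<in>B \<union> C. f b \<bullet> b)"
    using f fV orth B(3) C(3) span by (intro trace_on_orthonormal) auto
  also have "\<dots> = (\<Sum>b\<in>B. f b \<bullet> b) + (\<Sum>b\<in>C. f b \<bullet> b)"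
    using \<open>B \<inter> C = {}\<close> B(4) C(4) by (intro sum.union_disjoint) (auto dest: independent_imp_finite)
  also have "(\<Sum>b\<in>B. f b \<bullet> b) = trace_on S f"
    using f S(2) B by (intro trace_on_orthonormal[symmetric]) auto
  also have "(\<Sum>b\<in>C. f b \<bullet> b) = trace_on (V \<inter> S\<^sup>\<bottom>) f"
    using f inv C by (intro trace_on_orthonormal[symmetric]) auto
  finally show ?thesis .
qed

text \<open>
  Conjugation by an isomorphism preserves the trace: isomorphic representations have the same
  character.
\<close>

lemma trace_on_intertwine:
  fixes f :: "'a::euclidean_space \<Rightarrow> 'a" and f' :: "'b::euclidean_space \<Rightarrow> 'b"
  assumes f: "linear f" "f ` S \<subseteq> S" "linear f'" and S: "subspace S"
    and h: "linear h" "inj_on h S" "\<And>x. x \<in> S \<Longrightarrow> f' (h x) = h (f x)"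
  shows "trace_on (h ` S) f' = trace_on S f"
proof -
  obtain B where B: "B \<subseteq> S" "independent B" "span B = S"
    using orthonormal_basis_subspace[OF S] by metis
  have hB: "independent (h ` B)" "span (h ` B) = h ` S"
    using B h by (simp_all add: linear_independent_injective_image linear_span_image)
  have fin: "finite B"
    using B(2) by (rule independent_imp_finite)
  have inj: "inj_on h B"
    using h(2) B(1) by (rule inj_on_subset)
  have rep: "representation (h ` B) (h x) (h b) = representation B x b" if x: "x \<in> S" and b: "b \<in> B" for x b
  proof -
    \<comment> \<open>the coordinates of \<open>x\<close>, transported along the bijection \<open>h\<close> from \<open>B\<close> to \<open>h ` B\<close>\<close>
    let ?r = "\<lambda>c. if c \<in> h ` B then representation B x (inv_into B h c) else 0"
    have "representation (h ` B) (h x) = ?r"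
    proof (rule representation_eqI[OF hB(1)])
      show "h x \<in> span (h ` B)" using hB x by simp
      show "c \<in> h ` B" if "?r c \<noteq> 0" for c
        using that by (auto split: if_splits)
      have "{v. ?r v \<noteq> 0} \<subseteq> h ` B"
        by auto
      then show fin': "finite {v. ?r v \<noteq> 0}"
        using fin by (meson finite_imageI finite_subset)
      have "(\<Sum>v | ?r v \<noteq> 0. ?r v *\<^sub>R v) = (\<Sum>v\<in>h ` B. ?r v *\<^sub>R v)"
        using fin by (intro sum.mono_neutral_left) auto
      also have "\<dots> = (\<Sum>b\<in>B. representation B x b *\<^sub>R h b)"
        by (subst sum.reindex[OF inj]) (use inj in auto)
      also have "\<dots> = h (\<Sum>b\<in>B. representation B x b *\<^sub>R b)"
        using h(1) by (simp add: linear_sum linear_scale)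
      also have "\<dots> = h x"
        using real_vector.sum_representation_eq[OF B(2) _ fin] x B by simp
      finally show "(\<Sum>v | ?r v \<noteq> 0. ?r v *\<^sub>R v) = h x" .
    qed
    then show ?thesis
      using b inj by simp
  qed
  have "f' ` (h ` S) \<subseteq> h ` S"
    using f(2) h(3) by force
  then have "trace_on (h ` S) f' = (\<Sum>c\<in>h ` B. representation (h ` B) (f' c) c)"
    using f hB by (intro trace_on_eq) auto
  also have "\<dots> = (\<Sum>b\<in>B. representation (h ` B) (h (f b)) (h b))"
    using inj B(1) h(3) by (simp add: sum.reindex subset_iff)
  also have "\<dots> = (\<Sum>b\<in>B. representation B (f b) b)"
    using B(1) f(2) by (intro sum.cong refl rep) auto
  also have "\<dots> = trace_on S f"
    using f B by (intro trace_on_eq[symmetric]) auto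
  finally show ?thesis .
qed

text \<open>
  Because \<open>f\<close> is injective and \<open>S\<close> has finite dimension, \<open>f\<close> maps \<open>S\<close> onto \<open>S\<close>. Hence each vector of
  \<open>S\<close> is the image of a vector of \<open>S\<close>, and \<open>f\<close> preserves orthogonality to it.
\<close>

lemma orthogonal_transformation_invariant_comp:
  fixes f :: "'a::euclidean_space \<Rightarrow> 'a"
  assumes f: "orthogonal_transformation f" and S: "subspace S" "f ` S \<subseteq> S"
  shows "f ` (S\<^sup>\<bottom>) \<subseteq> S\<^sup>\<bottom>"
proof -
  have lin: "linear f" and inj: "inj f"
    using f by (auto simp: orthogonal_transformation_linear orthogonal_transformation_inj)
  have "f ` S = S"
  proof (rule subspace_dim_equal)
    show "dim S \<le> dim (f ` S)"
      using dim_image_eq[OF lin, of S] inj by (simp add: inj_on_subset)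
  qed (use S lin in \<open>auto simp: linear_subspace_image\<close>)
  show ?thesis
  proof (clarsimp simp: orthogonal_comp_def)
    fix x y assume x: "\<forall>s\<in>S. orthogonal s x" and "y \<in> S"
    then obtain s where "s \<in> S" "y = f s"
      using \<open>f ` S = S\<close> by blast
    then show "orthogonal y (f x)"
      using x f by (simp add: orthogonal_def orthogonal_transformation_def)
  qed
qed

lemma trace_on_zero: "trace_on {0} f = 0"
  if "linear f" for f :: "'a::euclidean_space \<Rightarrow> 'a"
  using that by (subst trace_on_eq[where B = "{}"]) (auto simp: linear_0 real_vector.independent_empty)

text \<open>
  Orthogonally to the kernel, \<open>R\<close> is an isomorphism onto its range, and the range is the orthogonal
  complement of the cokernel. As \<open>R\<close> intertwines \<open>A\<close> and \<open>B\<close>, these two complements contribute equal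
  traces, which cancel in the difference. This is the equivariant form of the fact that the index
  \<open>dim ker R - dim coker R\<close> depends only on the dimensions of the two spaces.
\<close>

lemma trace_ker_minus_coker:
  fixes R :: "real^'n^'m" and A :: "real^'n^'n" and B :: "real^'m^'m"
  assumes comm: "B ** R = R ** A"
    and A: "orthogonal_transformation ((*v) A)" and B: "orthogonal_transformation ((*v) B)"
  shows "trace_on {w. R *v w = 0} ((*v) A) - trace_on {s. transpose R *v s = 0} ((*v) B)
          = trace A - trace B"
proof -
  let ?K = "{w. R *v w = 0}" and ?C = "{s. transpose R *v s = 0}"
  have eq: "B *v (R *v x) = R *v (A *v x)" for x
    using comm by (simp add: matrix_vector_mul_assoc)
  have sub: "subspace ?K" "subspace ?C"
    by (auto simp: subspace_def matrix_vector_right_distrib matrix_vector_mult_scaleR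
        simp del: transpose_matrix_vector)
  have adj: "(R *v x) \<bullet> s = x \<bullet> (transpose R *v s)" for x s
    by (metis dot_lmul_matrix inner_commute transpose_matrix_vector)
  have iK: "(*v) A ` ?K \<subseteq> ?K"
    using eq by (auto simp flip: eq)
  have adjC: "s \<in> ?C \<longleftrightarrow> s \<in> (range ((*v) R))\<^sup>\<bottom>" for s
    using inner_eq_zero_iff[of "transpose R *v s"]
    by (auto simp: orthogonal_comp_def orthogonal_def adj simp del: transpose_matrix_vector inner_eq_zero_iff)
  then have C: "?C = (range ((*v) R))\<^sup>\<bottom>"
    by blast
  have subR: "subspace (range ((*v) R))"
    by (simp add: linear_subspace_image)
  then have C': "?C\<^sup>\<bottom> = range ((*v) R)"
    unfolding C by (rule orthogonal_comp_self)
  have iR: "(*v) B ` range ((*v) R) \<subseteq> range ((*v) R)"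
    by (auto simp: eq)
  have iC: "(*v) B ` ?C \<subseteq> ?C"
    unfolding C by (rule orthogonal_transformation_invariant_comp[OF B subR iR])
  have iK': "(*v) A ` (?K\<^sup>\<bottom>) \<subseteq> ?K\<^sup>\<bottom>"
    by (rule orthogonal_transformation_invariant_comp[OF A sub(1) iK])
  have inj: "inj_on ((*v) R) (?K\<^sup>\<bottom>)"
  proof (rule inj_onI)
    fix x y assume xy: "x \<in> ?K\<^sup>\<bottom>" "y \<in> ?K\<^sup>\<bottom>" "R *v x = R *v y"
    then have "x - y \<in> ?K\<^sup>\<bottom>"
      by (simp add: subspace_diff subspace_orthogonal_comp)
    moreover have "x - y \<in> ?K"
      using xy(3) by (simp add: matrix_vector_mult_diff_distrib)
    ultimately have "(x - y) \<bullet> (x - y) = 0"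
      unfolding orthogonal_comp_def orthogonal_def by blast
    then show "x = y"
      by simp
  qed
  have im: "(*v) R ` (?K\<^sup>\<bottom>) = range ((*v) R)"
  proof (intro equalityI subsetI)
    fix z assume "z \<in> range ((*v) R)"
    then obtain x where x: "z = R *v x" by blast
    have "x \<in> ?K + ?K\<^sup>\<bottom>"
      using subspace_sum_orthogonal_comp[OF sub(1)] by simp
    then obtain k u where "k \<in> ?K" "u \<in> ?K\<^sup>\<bottom>" "x = k + u"
      by (meson set_plus_elim)
    then show "z \<in> (*v) R ` (?K\<^sup>\<bottom>)"
      using x by (auto simp: matrix_vector_right_distrib)
  qed auto
  have "trace A = trace_on ?K ((*v) A) + trace_on (?K\<^sup>\<bottom>) ((*v) A)"
    using trace_on_orthogonal_split[of "(*v) A" ?K UNIV] sub(1) iK iK' by (simp add: trace_on_matrix)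
  moreover have "trace B = trace_on ?C ((*v) B) + trace_on (?C\<^sup>\<bottom>) ((*v) B)"
    using trace_on_orthogonal_split[of "(*v) B" ?C UNIV] sub(2) iC iR
    by (simp add: trace_on_matrix C' del: transpose_matrix_vector)
  moreover have "trace_on (?C\<^sup>\<bottom>) ((*v) B) = trace_on (?K\<^sup>\<bottom>) ((*v) A)"
    unfolding C' im[symmetric]
    using iK' inj by (intro trace_on_intertwine) (auto simp: eq subspace_orthogonal_comp)
  ultimately show ?thesis
    by simp
qed

section \<open>Lines and plane isometries\<close>

lemma line_at_hyperplane:
  assumes "a \<noteq> 0" "b \<noteq> 0"
  shows "{z. a \<bullet> z = b} = line_at ((b / (a \<bullet> a)) *\<^sub>R a)"
proof -
  have "(z - (b / (a \<bullet> a)) *\<^sub>R a) \<bullet> a = a \<bullet> z - b" for z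
    using assms by (simp add: inner_diff_left inner_commute[of z a])
  then show ?thesis
    using assms by (simp add: line_at_def)
qed

lemma straight_line_eq_line_at:
  assumes "straight_line X" "0 \<notin> X"
  shows "closest_point X 0 \<noteq> 0" "X = line_at (closest_point X 0)"
proof -
  have "affine X" "aff_dim X = int (DIM(real^2) - 1)"
    using assms by (auto simp: straight_line_def)
  then have "\<exists>a b. a \<noteq> 0 \<and> affine hull X = {z. a \<bullet> z = b}"
    by (intro aff_dim_eq_hyperplane[THEN iffD1])
  then obtain a b where ab: "a \<noteq> 0" "X = {z. a \<bullet> z = b}"
    using \<open>affine X\<close> by (auto simp: affine_hull_eq[THEN iffD2])
  then have "b \<noteq> 0" using assms by auto
  then have "X = line_at ((b / (a \<bullet> a)) *\<^sub>R a)"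
    using ab line_at_hyperplane by simp
  then show "closest_point X 0 \<noteq> 0" "X = line_at (closest_point X 0)"
    using ab \<open>b \<noteq> 0\<close> by (auto simp: closest_point_line_at)
qed

lemma orthogonal_matrix_inner:
  "orthogonal_matrix T \<Longrightarrow> (T *v x) \<bullet> (T *v y) = x \<bullet> y" for T :: "real^'n^'n"
  using orthogonal_transformation_matrix[of "(*v) T"] by (simp add: orthogonal_transformation_def)

lemma orthogonal_matrix_dist:
  "orthogonal_matrix T \<Longrightarrow> dist (T *v x + \<tau>) (T *v y + \<tau>) = dist x y" for T :: "real^'n^'n"
  by (simp add: dist_norm norm_eq_sqrt_inner orthogonal_matrix_inner flip: matrix_vector_mult_diff_distrib)

text \<open>
  The foot of the perpendicular from the origin to the image of \<^term>\<open>line_at a\<close> under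
  \<open>z \<mapsto> T z + \<tau>\<close>. The image has the normal vector \<open>T a\<close>, and translation by \<open>\<tau>\<close> slides the foot along
  that normal. If the factor vanishes, the image passes through the origin.
\<close>

definition moved_foot :: "real^2^2 \<Rightarrow> real^2 \<Rightarrow> real^2 \<Rightarrow> real^2" where
  "moved_foot T \<tau> a = (1 + \<tau> \<bullet> (T *v a) / (a \<bullet> a)) *\<^sub>R (T *v a)"

lemma image_line_at:
  assumes T: "orthogonal_matrix T" and a: "a \<noteq> 0 \<or> \<tau> = 0" and c: "1 + \<tau> \<bullet> (T *v a) / (a \<bullet> a) \<noteq> 0"
  shows "(\<lambda>z. T *v z + \<tau>) ` line_at a = line_at (moved_foot T \<tau> a)"
proof -
  let ?c = "1 + \<tau> \<bullet> (T *v a) / (a \<bullet> a)"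
  have bij: "surj (\<lambda>z. T *v z + \<tau>)"
  proof (rule surjI)
    show "T *v (transpose T *v (w - \<tau>)) + \<tau> = w" for w
      using T by (simp add: matrix_vector_mul_assoc orthogonal_matrix_def del: transpose_matrix_vector)
  qed
  have iff: "T *v z + \<tau> \<in> line_at (moved_foot T \<tau> a) \<longleftrightarrow> z \<in> line_at a" for z
  proof -
    have "(T *v z + \<tau> - ?c *\<^sub>R (T *v a)) \<bullet> (T *v a) = (z - a) \<bullet> a"
      using a T by (cases "a = 0")
        (auto simp: inner_diff_left inner_add_left algebra_simps orthogonal_matrix_inner)
    then show ?thesis
      using c by (simp add: line_at_def moved_foot_def)
  qed
  show ?thesis
  proof (intro equalityI subsetI)
    fix w assume w: "w \<in> line_at (moved_foot T \<tau> a)"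
    obtain z where "w = T *v z + \<tau>"
      using bij by blast
    then show "w \<in> (\<lambda>z. T *v z + \<tau>) ` line_at a"
      using w iff by blast
  qed (use iff in auto)
qed

lemma infdist_isometry_image:
  assumes "\<And>x y. dist (f x) (f y) = dist x y"
  shows "infdist (f x) (f ` A) = infdist x A"
  using assms by (simp add: infdist_def image_image)

lemma line_dir_inner: "line_dir a \<bullet> line_dir b = a \<bullet> b"
  by (simp add: line_dir_def inner_vec_def sum_2)

lemma line_angle_eq: "line_angle a b = arccos (\<bar>a \<bullet> b\<bar> / (norm a * norm b))"
  by (simp add: line_angle_def line_dir_inner norm_eq_sqrt_inner)

lemma line_angle_isometry_scale:
  assumes "orthogonal_matrix T" "c \<noteq> 0" "d \<noteq> 0"
  shows "line_angle (c *\<^sub>R (T *v a)) (d *\<^sub>R (T *v b)) = line_angle a b"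
proof -
  have "norm (T *v x) = norm x" for x
    using assms(1) by (simp add: norm_eq_sqrt_inner orthogonal_matrix_inner)
  then show ?thesis
    using assms by (simp add: line_angle_eq orthogonal_matrix_inner abs_mult)
qed

section \<open>Invariance of the generalised distances\<close>

text \<open>
  The object with label \<open>u\<close> in the configuration \<open>x\<close> is carried by \<open>z \<mapsto> T z + \<tau>\<close> onto the object with
  label \<open>u'\<close> in \<open>y\<close>. This covers both uses of isometries below: a spatial symmetry (\<open>\<tau> = 0\<close>, labels
  permuted) and a rigid motion (labels kept). In the first use \<open>x\<close> ranges over all configurations,
  so the block of a line may be \<open>0\<close>; in the second use the side conditions exclude this block, and also
  images through the origin, which \<^const>\<open>line_at\<close> cannot describe.
\<close>

definition moves_to ::
    "real^2^2 \<Rightarrow> real^2 \<Rightarrow> real^(('p::finite + 'l::finite) \<times> 2) \<Rightarrow> 'p + 'l \<Rightarrow> real^(('p + 'l) \<times> 2) \<Rightarrow> 'p + 'l \<Rightarrow> bool" where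
  "moves_to T \<tau> x u y u' \<longleftrightarrow>
     (\<exists>i i'. u = Inl i \<and> u' = Inl i' \<and> block y u' = T *v block x u + \<tau>) \<or>
     (\<exists>j j'. u = Inr j \<and> u' = Inr j' \<and> block y u' = moved_foot T \<tau> (block x u) \<and>
        (block x u \<noteq> 0 \<or> \<tau> = 0) \<and> 1 + \<tau> \<bullet> (T *v block x u) / (block x u \<bullet> block x u) \<noteq> 0)"

text \<open>
  All three generalised distances are invariant under isometries. For the angle it matters that
  moving a line rotates its foot and rescales it by a nonzero factor, to which \<^const>\<open>line_angle\<close> is
  insensitive.
\<close>

lemma gen_dist_moves_to:
  assumes T: "orthogonal_matrix T" and u: "moves_to T \<tau> x u y u'" and v: "moves_to T \<tau> x v y v'"
  shows "gen_dist y u' v' = gen_dist x u v"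
proof -
  have pl: "gen_dist y (Inl i') (Inr j') = gen_dist x (Inl i) (Inr j)"
    if "moves_to T \<tau> x (Inl i) y (Inl i')" "moves_to T \<tau> x (Inr j) y (Inr j')" for i i' j j'
  proof -
    have "block y (Inl i') = T *v block x (Inl i) + \<tau>"
      using that(1) by (simp add: moves_to_def)
    moreover have "line_at (block y (Inr j')) = (\<lambda>z. T *v z + \<tau>) ` line_at (block x (Inr j))"
      using that(2) image_line_at[OF T] by (simp add: moves_to_def)
    moreover have "infdist (T *v block x (Inl i) + \<tau>) ((\<lambda>z. T *v z + \<tau>) ` line_at (block x (Inr j)))
        = infdist (block x (Inl i)) (line_at (block x (Inr j)))"
      using orthogonal_matrix_dist[OF T] by (intro infdist_isometry_image[where f = "\<lambda>z. T *v z + \<tau>"])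
    ultimately show ?thesis
      by simp
  qed
  show ?thesis
  proof (cases u; cases v)
    fix i j assume uv: "u = Inl i" "v = Inl j"
    then obtain i' j' where "u' = Inl i'" "v' = Inl j'"
      using u v by (auto simp: moves_to_def)
    then show ?thesis
      using u v uv orthogonal_matrix_dist[OF T, of _ \<tau>] by (simp add: moves_to_def del: dist_add_cancel2)
  next
    fix i j assume uv: "u = Inr i" "v = Inr j"
    then obtain i' j' where "u' = Inr i'" "v' = Inr j'"
      using u v by (auto simp: moves_to_def)
    then show ?thesis
      using u v uv T by (simp add: moves_to_def moved_foot_def line_angle_isometry_scale)
  next
    fix i j assume uv: "u = Inl i" "v = Inr j"
    then obtain i' j' where "u' = Inl i'" "v' = Inr j'"
      using u v by (auto simp: moves_to_def)
    then show ?thesis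
      using u v uv pl by blast
  next
    fix i j assume uv: "u = Inr i" "v = Inl j"
    then obtain i' j' where "u' = Inr i'" "v' = Inl j'"
      using u v by (auto simp: moves_to_def)
    then show ?thesis
      using u v uv pl by (metis gen_dist_commute)
  qed
qed

section \<open>Configurations as vectors\<close>

definition unblock :: "('v::finite \<Rightarrow> real^2) \<Rightarrow> real^('v \<times> 2)" where
  "unblock h = (\<chi> vi. h (fst vi) $ snd vi)"

lemma block_unblock [simp]: "block (unblock h) v = h v"
  by (simp add: block_def unblock_def vec_eq_iff)

lemma block_eqI: "(\<And>v. block x v = block y v) \<Longrightarrow> x = y"
  by (auto simp: block_def vec_eq_iff)

lemma inner_block: "x \<bullet> y = (\<Sum>v\<in>UNIV. block x v \<bullet> block y v)"
  for x y :: "real^('v::finite \<times> 2)"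
  by (simp add: inner_vec_def block_def sum.cartesian_product)

lemma coords_unblock:
  "coords P L = unblock (case_sum P (\<lambda>j. closest_point (L j) 0))"
  by (simp add: coords_def unblock_def vec_eq_iff split: sum.split)

lemma has_vector_derivative_unblock:
  fixes h :: "real \<Rightarrow> 'v::finite \<Rightarrow> real^2"
  assumes "\<And>v. ((\<lambda>t. h t v) has_vector_derivative h' v) (at t)"
  shows "((\<lambda>t. unblock (h t)) has_vector_derivative unblock h') (at t)"
proof -
  have "((\<lambda>t. unblock (h t) \<bullet> b) has_derivative (\<lambda>s. (s *\<^sub>R unblock h') \<bullet> b)) (at t)"
    if b: "b \<in> Basis" for b :: "real^('v \<times> 2)"
  proof -
    obtain v i where "b = axis (v, i) 1"
      using b by (auto simp: Basis_vec_def)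
    moreover have "((\<lambda>t. h t v $ i) has_derivative (\<lambda>s. (s *\<^sub>R h' v) $ i)) (at t)"
      using assms[of v] unfolding has_vector_derivative_def
      by (rule bounded_linear.has_derivative[OF bounded_linear_vec_nth])
    ultimately show ?thesis
      by (simp add: inner_axis unblock_def)
  qed
  then show ?thesis
    unfolding has_vector_derivative_def by (subst has_derivative_componentwise_within) auto
qed

section \<open>Trivial flexes\<close>

lemma rotation_orthogonal: "orthogonal_matrix (rotation \<theta>)"
  unfolding orthogonal_matrix
  by (simp add: rotation_def matrix_matrix_mult_def transpose_def mat_def vec_eq_iff forall_2 sum_2
      power2_eq_square[symmetric])

lemma rotation_mult: "rotation \<theta> *v z = cos \<theta> *\<^sub>R z + sin \<theta> *\<^sub>R line_dir z"
  by (simp add: rotation_def line_dir_def matrix_vector_mult_def vec_eq_iff forall_2 sum_2 mult.commute)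

lemma inner_line_dir [simp]: "line_dir a \<bullet> a = 0" "a \<bullet> line_dir a = 0"
  by (simp_all add: line_dir_def inner_vec_def sum_2 mult.commute)

text \<open>
  The velocity of the configuration \<open>x\<close> under the infinitesimal motion with angular velocity
  \<open>fst m\<close> and translational velocity \<open>snd m\<close>. The rotation turns every block. The translation moves
  a point as it is, but moves the foot of a line only by its component along the normal of the line.
\<close>

definition rigid_velocity :: "real^(('p::finite + 'l::finite) \<times> 2) \<Rightarrow> real \<times> (real^2) \<Rightarrow> real^(('p + 'l) \<times> 2)" where
  "rigid_velocity x m = unblock (\<lambda>v. fst m *\<^sub>R line_dir (block x v) +
     (case v of Inl i \<Rightarrow> snd m | Inr j \<Rightarrow> (snd m \<bullet> block x v / (block x v \<bullet> block x v)) *\<^sub>R block x v))"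

lemma linear_rigid_velocity: "linear (rigid_velocity x)"
  by (rule linearI; rule block_eqI)
    (auto simp: rigid_velocity_def block_def unblock_def vec_eq_iff algebra_simps inner_add_left add_divide_distrib split: sum.split)

text \<open>
  The angular velocity can be read off at a line, whose foot moves orthogonally to itself only by the
  rotation; the translation can then be read off at a point.
\<close>

lemma inj_rigid_velocity:
  fixes x :: "real^(('p::finite + 'l::finite) \<times> 2)"
  assumes "\<And>j. block x (Inr j) \<noteq> 0"
  shows "inj (rigid_velocity x)"
proof (subst linear_injective_0[OF linear_rigid_velocity], clarify)
  fix \<omega> \<tau> assume 0: "rigid_velocity x (\<omega>, \<tau>) = 0"
  obtain j :: 'l where True by blast
  let ?a = "block x (Inr j)"
  have b0: "block 0 v = 0" for v :: "'p + 'l"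
    by (simp add: block_def vec_eq_iff)
  \<comment> \<open>any line will do; its two velocity components are orthogonal\<close>
  have "\<omega> *\<^sub>R line_dir ?a + (\<tau> \<bullet> ?a / (?a \<bullet> ?a)) *\<^sub>R ?a = 0"
    using arg_cong[OF 0, of "\<lambda>x. block x (Inr j)"] by (simp add: rigid_velocity_def b0)
  then have "(\<omega> *\<^sub>R line_dir ?a + (\<tau> \<bullet> ?a / (?a \<bullet> ?a)) *\<^sub>R ?a) \<bullet> line_dir ?a = 0"
    by simp
  then have "\<omega> = 0"
    using assms[of j] by (simp add: inner_add_left line_dir_inner)
  then show "(\<omega>, \<tau>) = 0"
    using arg_cong[OF 0, of "\<lambda>x. block x (Inl (undefined :: 'p))"] by (simp add: rigid_velocity_def b0 zero_prod_def)
qed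

lemma has_derivative_transform_nhds:
  assumes "(f has_derivative f') (at x)" "eventually (\<lambda>y. f y = g y) (nhds x)"
  shows "(g has_derivative f') (at x)"
  using assms by (intro has_derivative_transform_eventually[of f f' x UNIV g])
    (auto simp: eventually_nhds_conv_at)

lemma rotation_zero [simp]: "rotation 0 *v z = z"
  by (simp add: rotation_mult)

lemma has_vector_derivative_rotation:
  "((\<lambda>t. rotation (t * \<omega>) *v z) has_vector_derivative \<omega> *\<^sub>R line_dir z) (at 0)"
proof -
  have "((\<lambda>t. cos (t * \<omega>)) has_real_derivative 0) (at 0)"
    and "((\<lambda>t. sin (t * \<omega>)) has_real_derivative \<omega>) (at 0)"
    by (auto intro!: derivative_eq_intros)
  then have "((\<lambda>t. cos (t * \<omega>) *\<^sub>R z + sin (t * \<omega>) *\<^sub>R line_dir z)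
      has_vector_derivative (cos (0 * \<omega>) *\<^sub>R 0 + 0 *\<^sub>R z) + (sin (0 * \<omega>) *\<^sub>R 0 + \<omega> *\<^sub>R line_dir z)) (at 0)"
    by (intro has_vector_derivative_add has_vector_derivative_scaleR has_vector_derivative_const)
  then show ?thesis
    by (simp add: rotation_mult)
qed

lemma has_real_derivative_foot_factor:
  "((\<lambda>t. 1 + (t *\<^sub>R \<tau>) \<bullet> (rotation (t * \<omega>) *v a) / (a \<bullet> a))
     has_real_derivative \<tau> \<bullet> a / (a \<bullet> a)) (at 0)"
proof -
  have "((\<lambda>t. \<tau> \<bullet> (rotation (t * \<omega>) *v a)) has_real_derivative \<tau> \<bullet> (\<omega> *\<^sub>R line_dir a)) (at 0)"
    using bounded_linear.has_vector_derivative[OF bounded_linear_inner_right has_vector_derivative_rotation]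
    by (simp add: has_real_derivative_iff_has_vector_derivative)
  then have "((\<lambda>t. 1 + t * (\<tau> \<bullet> (rotation (t * \<omega>) *v a)) / (a \<bullet> a)) has_real_derivative
      0 + (0 * (\<tau> \<bullet> (\<omega> *\<^sub>R line_dir a)) + 1 * (\<tau> \<bullet> (rotation (0 * \<omega>) *v a))) / (a \<bullet> a)) (at 0)"
    by (intro DERIV_add DERIV_const DERIV_cdivide DERIV_mult' DERIV_ident)
  then show ?thesis
    by simp
qed

lemma has_vector_derivative_moved_foot:
  "((\<lambda>t. moved_foot (rotation (t * \<omega>)) (t *\<^sub>R \<tau>) a)
     has_vector_derivative \<omega> *\<^sub>R line_dir a + (\<tau> \<bullet> a / (a \<bullet> a)) *\<^sub>R a) (at 0)"
  using has_vector_derivative_scaleR[OF has_real_derivative_foot_factor[of \<tau> \<omega> a]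
      has_vector_derivative_rotation[of \<omega> a]]
  by (simp add: moved_foot_def)

lemma eventually_foot_factor_nonzero:
  "eventually (\<lambda>t. 1 + (t *\<^sub>R \<tau>) \<bullet> (rotation (t * \<omega>) *v a) / (a \<bullet> a) \<noteq> 0) (nhds 0)"
proof -
  have "isCont (\<lambda>t. 1 + (t *\<^sub>R \<tau>) \<bullet> (rotation (t * \<omega>) *v a) / (a \<bullet> a)) 0"
    using has_real_derivative_foot_factor DERIV_isCont by blast
  then have "eventually (\<lambda>t. 1 + (t *\<^sub>R \<tau>) \<bullet> (rotation (t * \<omega>) *v a) / (a \<bullet> a) \<noteq> 0) (at 0)"
    unfolding isCont_def by (rule tendsto_imp_eventually_ne) simp
  then show ?thesis
    by (simp add: eventually_nhds_conv_at)
qed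

definition rigid_curve ::
  "('p::finite \<Rightarrow> real^2) \<Rightarrow> ('l::finite \<Rightarrow> (real^2) set) \<Rightarrow> real \<Rightarrow> real^2 \<Rightarrow> real \<Rightarrow> real^(('p + 'l) \<times> 2)" where
  "rigid_curve P L \<omega> \<tau> t =
     coords (\<lambda>i. rigid_motion (t * \<omega>) (t *\<^sub>R \<tau>) (P i)) (\<lambda>j. rigid_motion (t * \<omega>) (t *\<^sub>R \<tau>) ` L j)"

lemma block_coords:
  "block (coords P L) (Inl i) = P i" "block (coords P L) (Inr j) = closest_point (L j) 0"
  by (simp_all add: coords_unblock)

lemma framework_lines:
  assumes "point_line_framework ends P L"
  shows "block (coords P L) (Inr j) \<noteq> 0" "L j = line_at (block (coords P L) (Inr j))"
  using assms straight_line_eq_line_at[of "L j"] by (auto simp: point_line_framework_def block_coords)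

text \<open>
  The lines of the framework avoid the origin, and by continuity they still do so after a small
  rigid motion. Only then do their feet determine them.
\<close>

lemma eventually_rigid_curve_moves_to:
  assumes "point_line_framework ends P L"
  shows "eventually (\<lambda>t. \<forall>v. moves_to (rotation (t * \<omega>)) (t *\<^sub>R \<tau>) (coords P L) v (rigid_curve P L \<omega> \<tau> t) v) (nhds 0)"
proof (rule eventually_all_finite)
  fix v
  show "eventually (\<lambda>t. moves_to (rotation (t * \<omega>)) (t *\<^sub>R \<tau>) (coords P L) v (rigid_curve P L \<omega> \<tau> t) v) (nhds 0)"
  proof (cases v)
    case (Inl i)
    then show ?thesis
      by (auto simp: moves_to_def rigid_curve_def block_coords rigid_motion_def)
  next
    case (Inr j)
    let ?a = "block (coords P L) (Inr j)"
    note a = framework_lines[OF assms, of j]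
    show ?thesis
      using eventually_foot_factor_nonzero[of \<tau> \<omega> ?a]
    proof eventually_elim
      case (elim t)
      have "(\<lambda>z. rigid_motion (t * \<omega>) (t *\<^sub>R \<tau>) z) ` line_at ?a = line_at (moved_foot (rotation (t * \<omega>)) (t *\<^sub>R \<tau>) ?a)"
        unfolding rigid_motion_def using a(1) elim rotation_orthogonal by (intro image_line_at) auto
      then have "block (rigid_curve P L \<omega> \<tau> t) (Inr j) = moved_foot (rotation (t * \<omega>)) (t *\<^sub>R \<tau>) ?a"
        using a(2) closest_point_line_at by (metis (no_types, lifting) block_coords(2) rigid_curve_def)
      then show ?case
        using Inr a(1) elim by (auto simp: moves_to_def)
    qed
  qed
qed

lemma rigid_curve_0:
  "rigid_curve P L \<omega> \<tau> 0 = coords P L"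
  by (simp add: rigid_curve_def rigid_motion_def)

lemma has_vector_derivative_rigid_curve:
  assumes "point_line_framework ends P L"
  shows "(rigid_curve P L \<omega> \<tau> has_vector_derivative rigid_velocity (coords P L) (\<omega>, \<tau>)) (at 0)"
proof -
  let ?x = "coords P L"
  let ?h = "\<lambda>t v. case v of Inl i \<Rightarrow> rotation (t * \<omega>) *v block ?x v + t *\<^sub>R \<tau>
              | Inr j \<Rightarrow> moved_foot (rotation (t * \<omega>)) (t *\<^sub>R \<tau>) (block ?x v)"
  \<comment> \<open>\<open>rigid_curve\<close> is defined by closest points; near \<open>0\<close> it has the closed form \<open>?h\<close>, which is differentiated\<close>
  have ev: "eventually (\<lambda>t. unblock (?h t) = rigid_curve P L \<omega> \<tau> t) (nhds 0)"
    using eventually_rigid_curve_moves_to[OF assms, of \<omega> \<tau>]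
  proof eventually_elim
    case (elim t)
    show ?case
    proof (rule block_eqI)
      fix v show "block (unblock (?h t)) v = block (rigid_curve P L \<omega> \<tau> t) v"
        using elim[rule_format, of v] by (cases v) (auto simp: moves_to_def)
    qed
  qed
  have "((\<lambda>t. unblock (?h t)) has_vector_derivative rigid_velocity ?x (\<omega>, \<tau>)) (at 0)"
    unfolding rigid_velocity_def
  proof (rule has_vector_derivative_unblock)
    fix v
    show "((\<lambda>t. ?h t v) has_vector_derivative fst (\<omega>, \<tau>) *\<^sub>R line_dir (block ?x v) +
        (case v of Inl i \<Rightarrow> snd (\<omega>, \<tau>)
         | Inr j \<Rightarrow> (snd (\<omega>, \<tau>) \<bullet> block ?x v / (block ?x v \<bullet> block ?x v)) *\<^sub>R block ?x v)) (at 0)"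
    proof (cases v)
      case (Inl i)
      have "((\<lambda>t. t *\<^sub>R \<tau>) has_vector_derivative \<tau>) (at 0)"
        using has_vector_derivative_scaleR[OF DERIV_ident has_vector_derivative_const, of \<tau> 0 UNIV] by simp
      with Inl show ?thesis
        by (simp add: has_vector_derivative_add has_vector_derivative_rotation)
    next
      case (Inr j)
      then show ?thesis
        by (simp add: has_vector_derivative_moved_foot)
    qed
  qed
  then show ?thesis
    unfolding has_vector_derivative_def
    using ev by (rule has_derivative_transform_nhds)
qed

lemma H_rig_eq:
  assumes "point_line_framework ends P L"
  shows "H_rig P L = range (rigid_velocity (coords P L))"
proof -
  have "(rigid_curve P L \<omega> \<tau> has_vector_derivative w) (at 0) \<longleftrightarrow> w = rigid_velocity (coords P L) (\<omega>, \<tau>)" for w \<omega> \<tau>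
    using has_vector_derivative_rigid_curve[OF assms] vector_derivative_unique_at by blast
  moreover have "H_rig P L = {w. \<exists>\<omega> \<tau>. (rigid_curve P L \<omega> \<tau> has_vector_derivative w) (at 0)}"
    by (simp add: H_rig_def rigid_curve_def[abs_def])
  ultimately show ?thesis
    by auto
qed

section \<open>The rigidity matrix as a derivative\<close>

lemma simple_graph_ends:
  assumes "simple_graph ends"
  obtains u v where "ends e = {u, v}" "u \<noteq> v"
proof -
  have "card (ends e) = 2"
    using assms by (simp add: simple_graph_def)
  then show ?thesis
    using that by (auto simp: card_2_iff)
qed

lemma has_derivative_edge_dists:
  assumes "point_line_framework ends P L"
  shows "((\<lambda>x. \<chi> e. edge_dist ends e x) has_derivative (*v) (rigidity_matrix ends P L)) (at (coords P L))"
proof -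
  have "(\<lambda>x. \<chi> e. edge_dist ends e x) differentiable at (coords P L)"
    using assms
    by (subst differentiable_componentwise_within)
      (auto simp: point_line_framework_def Basis_vec_def inner_axis)
  then show ?thesis
    unfolding rigidity_matrix_def by (simp add: jacobian_works)
qed

text \<open>
  Near time \<open>0\<close> all generalised distances are constant along the curve of rigid motions, so their
  derivative in the direction of its velocity vanishes.
\<close>

lemma rigid_velocity_in_kernel:
  assumes F: "point_line_framework ends P L"
  shows "rigidity_matrix ends P L *v rigid_velocity (coords P L) (\<omega>, \<tau>) = 0"
proof -
  let ?f = "\<lambda>x. \<chi> e. edge_dist ends e x"
  have "eventually (\<lambda>t. ?f (coords P L) = (?f \<circ> rigid_curve P L \<omega> \<tau>) t) (nhds 0)"
    using eventually_rigid_curve_moves_to[OF F, of \<omega> \<tau>]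
  proof eventually_elim
    case (elim t)
    have "edge_dist ends e (rigid_curve P L \<omega> \<tau> t) = edge_dist ends e (coords P L)" for e
    proof -
      obtain u v where "ends e = {u, v}"
        using simple_graph_ends F by (metis point_line_framework_def)
      then show ?thesis
        using gen_dist_moves_to[OF rotation_orthogonal elim[rule_format] elim[rule_format], of u v]
        by (simp add: edge_dist_eq)
    qed
    then show ?case
      by simp
  qed
  then have "((?f \<circ> rigid_curve P L \<omega> \<tau>) has_derivative (\<lambda>s. 0)) (at 0)"
    by (rule has_derivative_transform_nhds[OF has_derivative_const])
  moreover have "((?f \<circ> rigid_curve P L \<omega> \<tau>) has_derivative
      (*v) (rigidity_matrix ends P L) \<circ> (\<lambda>s. s *\<^sub>R rigid_velocity (coords P L) (\<omega>, \<tau>))) (at 0)"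
    using has_vector_derivative_rigid_curve[OF F, of \<omega> \<tau>] has_derivative_edge_dists[OF F]
    by (intro diff_chain_at) (simp_all add: has_vector_derivative_def rigid_curve_0)
  ultimately have "(*v) (rigidity_matrix ends P L) \<circ> (\<lambda>s. s *\<^sub>R rigid_velocity (coords P L) (\<omega>, \<tau>)) = (\<lambda>s. 0)"
    using has_derivative_unique by blast
  from fun_cong[OF this, of 1] show ?thesis
    by simp
qed

section \<open>The representations of the spatial symmetry group\<close>

lemma spatial_group_carrier_iff:
  "g \<in> carrier (spatial_group ends P L) \<longleftrightarrow>
     graph_automorphism ends (fst g) \<and> orthogonal_matrix (snd g) \<and>
     (\<forall>v. (*v) (snd g) ` located P L v = located P L (fst g v))"
  by (simp add: spatial_group_def split_beta)

text \<open>
  A spatial symmetry acts on the space of all configurations as it acts on the framework itself. Later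
  proofs see the Kronecker product only through this action and through its trace.
\<close>

lemma block_rho_v:
  assumes "inj (fst g)"
  shows "block (rho_v g *v x) (fst g v) = snd g *v block x v"
proof -
  have "(\<Sum>w\<in>UNIV. rho_v g $ (fst g v, i) $ w * x $ w) = (\<Sum>k\<in>UNIV. snd g $ i $ k * x $ (v, k))" for i
  proof -
    have "(\<Sum>w\<in>UNIV. rho_v g $ (fst g v, i) $ w * x $ w)
        = (\<Sum>u\<in>UNIV. \<Sum>k\<in>UNIV. if u = v then snd g $ i $ k * x $ (u, k) else 0)"
      using assms unfolding sum.cartesian_product UNIV_Times_UNIV
      by (intro sum.cong) (auto simp: rho_v_def kronecker_def rho_n_def rho_sp_def inj_eq)
    also have "\<dots> = (\<Sum>k\<in>UNIV. snd g $ i $ k * x $ (v, k))"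
      by (subst sum.swap) simp
    finally show ?thesis .
  qed
  then show ?thesis
    by (simp add: block_def matrix_vector_mult_def vec_eq_iff)
qed

lemma orthogonal_transformation_rho_v:
  assumes "bij (fst g)" "orthogonal_matrix (snd g)"
  shows "orthogonal_transformation ((*v) (rho_v g))"
proof -
  have "(rho_v g *v x) \<bullet> (rho_v g *v y) = x \<bullet> y" for x y
  proof -
    have "(rho_v g *v x) \<bullet> (rho_v g *v y)
        = (\<Sum>v\<in>UNIV. block (rho_v g *v x) (fst g v) \<bullet> block (rho_v g *v y) (fst g v))"
      unfolding inner_block by (rule sum.reindex_bij_betw[symmetric]) (use assms in simp)
    also have "\<dots> = x \<bullet> y"
      using assms by (simp add: block_rho_v bij_is_inj orthogonal_matrix_inner inner_block[of x y])
    finally show ?thesis .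
  qed
  then show ?thesis
    by (simp add: orthogonal_transformation_def)
qed

lemma trace_rho_v: "trace (rho_v g) = trace (rho_n g) * trace (rho_sp g)"
  by (simp add: trace_def rho_v_def kronecker_def sum_product sum.cartesian_product split_beta)

text \<open>
  The action of \<open>\<sigma>\<close> on the indices of the edges; it is determined by \<open>\<sigma>\<close> because \<open>ends\<close> is injective on
  a simple graph.
\<close>

definition edge_perm :: "('e \<Rightarrow> 'v set) \<Rightarrow> ('v \<Rightarrow> 'v) \<Rightarrow> 'e \<Rightarrow> 'e" where
  "edge_perm ends \<sigma> e = inv_into UNIV ends (\<sigma> ` ends e)"

lemma ends_edge_perm:
  assumes "simple_graph ends" "graph_automorphism ends \<sigma>"
  shows "ends (edge_perm ends \<sigma> e) = \<sigma> ` ends e"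
proof -
  obtain u v where uv: "ends e = {u, v}"
    using simple_graph_ends[OF assms(1)] by metis
  have "{u, v} \<in> range ends"
    using uv by (metis rangeI)
  then have "{\<sigma> u, \<sigma> v} \<in> range ends"
    using assms(2) by (simp only: graph_automorphism_def)
  then have "\<sigma> ` ends e \<in> range ends"
    by (simp add: uv)
  then show ?thesis
    unfolding edge_perm_def by (rule f_inv_into_f)
qed

lemma bij_edge_perm:
  assumes "simple_graph ends" "graph_automorphism ends \<sigma>"
  shows "bij (edge_perm ends \<sigma>)"
proof -
  have "inj \<sigma>" "inj ends"
    using assms by (auto simp: graph_automorphism_def simple_graph_def bij_is_inj)
  then have "e = f" if "edge_perm ends \<sigma> e = edge_perm ends \<sigma> f" for e f
    using arg_cong[OF that, of ends] by (simp add: ends_edge_perm[OF assms] inj_image_eq_iff inj_eq)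
  then have "inj (edge_perm ends \<sigma>)"
    by (rule injI)
  then show ?thesis
    by (simp add: bij_betw_def finite_UNIV_inj_surj)
qed

lemma rho_e_component:
  assumes "simple_graph ends" "graph_automorphism ends (fst g)"
  shows "(rho_e ends g *v s) $ edge_perm ends (fst g) e = s $ e"
proof -
  have "inj (fst g)" "inj ends"
    using assms by (auto simp: graph_automorphism_def simple_graph_def bij_is_inj)
  then have "fst g ` ends e = fst g ` ends f \<longleftrightarrow> e = f" for f
    by (auto simp: inj_image_eq_iff inj_eq)
  then show ?thesis
    by (simp add: rho_e_def matrix_vector_mult_def ends_edge_perm[OF assms] if_distrib[of "\<lambda>x. x * _"] cong: if_cong)
qed

lemma orthogonal_transformation_rho_e:
  assumes "simple_graph ends" "graph_automorphism ends (fst g)"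
  shows "orthogonal_transformation ((*v) (rho_e ends g))"
proof -
  have "(rho_e ends g *v x) \<bullet> (rho_e ends g *v y) = x \<bullet> y" for x y
  proof -
    have "(rho_e ends g *v x) \<bullet> (rho_e ends g *v y)
        = (\<Sum>e\<in>UNIV. (rho_e ends g *v x) $ edge_perm ends (fst g) e * (rho_e ends g *v y) $ edge_perm ends (fst g) e)"
      unfolding inner_vec_def inner_real_def
      by (rule sum.reindex_bij_betw[symmetric]) (rule bij_edge_perm[OF assms])
    also have "\<dots> = x \<bullet> y"
      using assms by (simp add: rho_e_component inner_vec_def)
    finally show ?thesis .
  qed
  then show ?thesis
    by (simp add: orthogonal_transformation_def)
qed

lemma rho_e_inverse:
  assumes S: "simple_graph ends" and g: "graph_automorphism ends (fst g)" and h: "graph_automorphism ends (fst h)"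
    and hg: "fst h \<circ> fst g = id"
  shows "rho_e ends h ** rho_e ends g = mat 1"
proof -
  have "(rho_e ends h *v (rho_e ends g *v s)) $ e = s $ e" for s e
  proof -
    have "ends (edge_perm ends (fst h) (edge_perm ends (fst g) e)) = ends e"
      using hg by (simp add: ends_edge_perm S g h image_comp)
    then have "edge_perm ends (fst h) (edge_perm ends (fst g) e) = e"
      using S by (simp add: simple_graph_def inj_eq)
    then show ?thesis
      using rho_e_component[OF S h, of "rho_e ends g *v s" "edge_perm ends (fst g) e"] rho_e_component[OF S g, of s e]
      by simp
  qed
  then show ?thesis
    by (simp add: matrix_eq matrix_vector_mul_assoc[symmetric] vec_eq_iff)
qed

lemma trace_rho_e: "trace (rho_e ends g) = card (unchanged ends g)"
  by (simp add: trace_def rho_e_def unchanged_def sum.If_cases eq_commute[of "ends _"])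

section \<open>Equivariance of the rigidity matrix\<close>

lemma graph_automorphism_type:
  assumes "graph_automorphism ends \<sigma>"
  shows "\<exists>i'. \<sigma> (Inl i) = Inl i'" "\<exists>j'. \<sigma> (Inr j) = Inr j'"
  using assms by (auto simp: graph_automorphism_def)

lemma moves_to_rho_v:
  assumes "graph_automorphism ends (fst g)"
  shows "moves_to (snd g) 0 x v (rho_v g *v x) (fst g v)"
proof -
  have b: "block (rho_v g *v x) (fst g v) = snd g *v block x v"
    using assms by (intro block_rho_v) (auto simp: graph_automorphism_def bij_is_inj)
  show ?thesis
    using graph_automorphism_type[OF assms] b by (cases v) (auto simp: moves_to_def moved_foot_def)
qed

text \<open>
  This is the nonlinear form of the equivariance of the rigidity matrix. It holds at every
  configuration, which is what allows it to be differentiated.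
\<close>

lemma edge_dist_rho_v:
  assumes S: "simple_graph ends" and g: "graph_automorphism ends (fst g)" "orthogonal_matrix (snd g)"
  shows "(\<chi> e. edge_dist ends e (rho_v g *v x)) = rho_e ends g *v (\<chi> e. edge_dist ends e x)"
proof -
  have "edge_dist ends e' (rho_v g *v x) = (rho_e ends g *v (\<chi> e. edge_dist ends e x)) $ e'" for e'
  proof -
    obtain e where e: "e' = edge_perm ends (fst g) e"
      using bij_edge_perm[OF S g(1)] by (metis bij_pointE)
    obtain u v where uv: "ends e = {u, v}"
      using simple_graph_ends[OF S] by metis
    have "ends e' = {fst g u, fst g v}"
      by (simp add: e ends_edge_perm[OF S g(1)] uv)
    then have "edge_dist ends e' (rho_v g *v x) = gen_dist (rho_v g *v x) (fst g u) (fst g v)"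
      by (rule edge_dist_eq)
    also have "\<dots> = gen_dist x u v"
      by (rule gen_dist_moves_to[OF g(2) moves_to_rho_v[OF g(1)] moves_to_rho_v[OF g(1)]])
    also have "\<dots> = edge_dist ends e x"
      using edge_dist_eq[of ends e u v x] uv by simp
    finally show ?thesis
      using rho_e_component[OF S g(1), of "\<chi> e. edge_dist ends e x" e] by (simp add: e)
  qed
  then show ?thesis
    by (simp add: vec_eq_iff)
qed

lemma rho_v_coords:
  assumes F: "point_line_framework ends P L" and g: "g \<in> carrier (spatial_group ends P L)"
  shows "rho_v g *v coords P L = coords P L"
proof -
  have a: "graph_automorphism ends (fst g)" and o: "orthogonal_matrix (snd g)"
    and m: "\<And>v. (*v) (snd g) ` located P L v = located P L (fst g v)"
    using g by (auto simp: spatial_group_carrier_iff)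
  have b: "bij (fst g)"
    using a by (simp add: graph_automorphism_def)
  have "block (coords P L) (fst g v) = snd g *v block (coords P L) v" for v
  proof (cases v)
    case (Inl i)
    obtain i' where i': "fst g (Inl i) = Inl i'"
      using graph_automorphism_type(1)[OF a] by blast
    have "snd g *v P i = P i'"
      using m[of "Inl i"] unfolding i' by (simp add: located_def)
    then show ?thesis
      by (simp add: Inl i' block_coords)
  next
    case (Inr j)
    obtain j' where j': "fst g (Inr j) = Inr j'"
      using graph_automorphism_type(2)[OF a] by blast
    have "L j' = (*v) (snd g) ` L j"
      using m[of "Inr j"] unfolding j' by (simp add: located_def)
    also have "\<dots> = (*v) (snd g) ` line_at (block (coords P L) (Inr j))"
      using framework_lines(2)[OF F, of j] by simp
    also have "\<dots> = line_at (snd g *v block (coords P L) (Inr j))"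
      using image_line_at[OF o, of "block (coords P L) (Inr j)" 0] by (simp add: moved_foot_def)
    finally have "closest_point (L j') 0 = snd g *v block (coords P L) (Inr j)"
      by (simp add: closest_point_line_at)
    then show ?thesis
      by (simp add: Inr j' block_coords)
  qed
  then have "block (rho_v g *v coords P L) (fst g v) = block (coords P L) (fst g v)" for v
    using b by (simp add: block_rho_v bij_is_inj)
  then show ?thesis
    using b by (intro block_eqI) (metis bij_pointE)
qed

text \<open>
  The framework is a fixed point of \<^term>\<open>rho_v g\<close>, so at the framework the chain rule turns the
  equivariance of the distances into that of their Jacobian matrix.
\<close>

lemma rigidity_matrix_equivariant:
  assumes F: "point_line_framework ends P L" and g: "g \<in> carrier (spatial_group ends P L)"
  shows "rho_e ends g ** rigidity_matrix ends P L = rigidity_matrix ends P L ** rho_v g"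
proof -
  let ?f = "\<lambda>x. \<chi> e. edge_dist ends e x"
  have a: "graph_automorphism ends (fst g)" and o: "orthogonal_matrix (snd g)" and S: "simple_graph ends"
    using g F by (auto simp: spatial_group_carrier_iff point_line_framework_def)
  note D = has_derivative_edge_dists[OF F]
  have "(?f \<circ> (*v) (rho_v g) has_derivative (*v) (rigidity_matrix ends P L) \<circ> (*v) (rho_v g)) (at (coords P L))"
    using D by (intro diff_chain_at) (simp_all add: rho_v_coords[OF F g] bounded_linear_imp_has_derivative)
  moreover have "((*v) (rho_e ends g) \<circ> ?f has_derivative (*v) (rho_e ends g) \<circ> (*v) (rigidity_matrix ends P L)) (at (coords P L))"
    using D by (intro diff_chain_at) (simp_all add: bounded_linear_imp_has_derivative)
  moreover have "?f \<circ> (*v) (rho_v g) = (*v) (rho_e ends g) \<circ> ?f"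
    using edge_dist_rho_v[OF S a o] by (auto simp: fun_eq_iff)
  ultimately have "(*v) (rigidity_matrix ends P L) \<circ> (*v) (rho_v g) = (*v) (rho_e ends g) \<circ> (*v) (rigidity_matrix ends P L)"
    using has_derivative_unique by metis
  then show ?thesis
    by (simp add: matrix_eq fun_eq_iff matrix_vector_mul_assoc)
qed

section \<open>The characters of the framework\<close>

text \<open>
  \<^const>\<open>line_dir\<close> is the rotation by a right angle. Rotations commute with it and reflections
  reverse it.
\<close>

lemma orthogonal_matrix_line_dir:
  assumes "orthogonal_matrix T"
  shows "T *v line_dir z = det T *\<^sub>R line_dir (T *v z)"
proof -
  let ?a = "T $ 1 $ 1" and ?b = "T $ 1 $ 2" and ?c = "T $ 2 $ 1" and ?d = "T $ 2 $ 2"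
  have "?a * ?a + ?c * ?c = 1" "?a * ?b + ?c * ?d = 0" "?b * ?b + ?d * ?d = 1"
    using assms unfolding orthogonal_matrix
    by (simp_all add: matrix_matrix_mult_def transpose_def mat_def vec_eq_iff forall_2 sum_2)
  \<comment> \<open>the inverse of \<open>T\<close> is its transpose, so the cofactor matrix of \<open>T\<close> is \<open>det T\<close> times \<open>T\<close>\<close>
  then have "?a = (?a * ?d - ?b * ?c) * ?d" "?b = - (?a * ?d - ?b * ?c) * ?c"
      "?c = - (?a * ?d - ?b * ?c) * ?b" "?d = (?a * ?d - ?b * ?c) * ?a"
    by algebra+
  then have e: "?a = det T * ?d" "?b = - det T * ?c" "?c = - det T * ?b" "?d = det T * ?a"
    unfolding det_2 by simp_all
  have "- ?a * z $ 2 + ?b * z $ 1 = - (det T * (?c * z $ 1 + ?d * z $ 2))"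
    "- ?c * z $ 2 + ?d * z $ 1 = det T * (?a * z $ 1 + ?b * z $ 2)"
    using e by algebra+
  then show ?thesis
    by (simp add: line_dir_def matrix_vector_mult_def vec_eq_iff forall_2 sum_2 algebra_simps)
qed

lemma rho_v_rigid_velocity:
  assumes F: "point_line_framework ends P L" and g: "g \<in> carrier (spatial_group ends P L)"
  shows "rho_v g *v rigid_velocity (coords P L) m
           = rigid_velocity (coords P L) (det (snd g) * fst m, snd g *v snd m)"
proof -
  let ?x = "coords P L" and ?T = "snd g"
  have a: "graph_automorphism ends (fst g)" and o: "orthogonal_matrix ?T"
    using g by (auto simp: spatial_group_carrier_iff)
  then have b: "bij (fst g)"
    by (simp add: graph_automorphism_def)
  have x: "block ?x (fst g v) = ?T *v block ?x v" for v
    using block_rho_v[of g ?x v] b rho_v_coords[OF F g] by (simp add: bij_is_inj)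
  have "block (rho_v g *v rigid_velocity ?x m) (fst g v)
      = block (rigid_velocity ?x (det ?T * fst m, ?T *v snd m)) (fst g v)" for v
  proof -
    have l: "block (rho_v g *v rigid_velocity ?x m) (fst g v) = ?T *v block (rigid_velocity ?x m) v"
      using b by (simp add: block_rho_v bij_is_inj)
    show ?thesis
    proof (cases v)
      case (Inl i)
      obtain i' where "fst g v = Inl i'"
        using graph_automorphism_type(1)[OF a] Inl by blast
      then show ?thesis
        unfolding l using x[of v]
        by (simp add: Inl rigid_velocity_def matrix_vector_right_distrib
            matrix_vector_mult_scaleR orthogonal_matrix_line_dir[OF o])
    next
      case (Inr j)
      obtain j' where "fst g v = Inr j'"
        using graph_automorphism_type(2)[OF a] Inr by blast
      then show ?thesis
        unfolding l using x[of v]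
        by (simp add: Inr rigid_velocity_def matrix_vector_right_distrib
            matrix_vector_mult_scaleR orthogonal_matrix_line_dir[OF o] orthogonal_matrix_inner[OF o])
    qed
  qed
  then show ?thesis
    using b by (intro block_eqI) (metis bij_pointE)
qed

lemma subspace_kernel: "subspace {w. A *v w = 0}" for A :: "real^'n^'m"
  by (auto simp: subspace_def matrix_vector_right_distrib matrix_vector_mult_scaleR)

lemma H_rig_invariant:
  assumes "point_line_framework ends P L" "g \<in> carrier (spatial_group ends P L)"
  shows "(*v) (rho_v g) ` H_rig P L \<subseteq> H_rig P L"
  using rho_v_rigid_velocity[OF assms] by (auto simp: H_rig_eq[OF assms(1)])

text \<open>
  Infinitesimal rigid motions transform under an isometry as an angular velocity, which is multiplied
  by the determinant, together with a translation vector, which is transformed by the isometry itself.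
\<close>

lemma chi_rig_eq:
  assumes F: "point_line_framework ends P L" and g: "g \<in> carrier (spatial_group ends P L)"
  shows "chi_rig P L g = det (snd g) + trace (snd g)"
proof -
  let ?f = "\<lambda>m :: real \<times> (real^2). (det (snd g) * fst m, snd g *v snd m)"
  have lin: "linear ?f"
    by (rule linearI) (auto simp: algebra_simps matrix_vector_right_distrib matrix_vector_mult_scaleR)
  have inj: "inj (rigid_velocity (coords P L))"
    using framework_lines(1)[OF F] by (rule inj_rigid_velocity)
  have "chi_rig P L g = trace_on (rigid_velocity (coords P L) ` UNIV) ((*v) (rho_v g))"
    by (simp add: chi_rig_def H_rig_eq[OF F])
  also have "\<dots> = trace_on UNIV ?f"
    using lin inj by (intro trace_on_intertwine) (auto simp: linear_rigid_velocity rho_v_rigid_velocity[OF F g])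
  also have "\<dots> = (\<Sum>m\<in>Basis. ?f m \<bullet> m)"
    using lin by (rule trace_on_UNIV)
  also have "\<dots> = det (snd g) + (\<Sum>b\<in>Basis. (snd g *v b) \<bullet> b)"
    unfolding Basis_prod_def
    by (subst sum.union_disjoint) (auto simp: sum.reindex inj_on_def)
  also have "(\<Sum>b\<in>Basis. (snd g *v b) \<bullet> b) = trace (snd g)"
    using trace_on_UNIV[of "(*v) (snd g)"] by (simp add: trace_on_matrix)
  finally show ?thesis .
qed

text \<open>
  By definition the mechanisms are the complement of the trivial flexes in the kernel. The latter lie in
  the kernel, and both spaces are invariant, so the trace on the kernel splits.
\<close>

lemma chi_mech_eq:
  assumes F: "point_line_framework ends P L" and g: "g \<in> carrier (spatial_group ends P L)"
  shows "chi_mech ends P L g = trace_on {w. rigidity_matrix ends P L *v w = 0} ((*v) (rho_v g)) - chi_rig P L g"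
proof -
  let ?R = "rigidity_matrix ends P L"
  let ?K = "{w. ?R *v w = 0}" and ?H = "H_rig P L"
  have orth: "orthogonal_transformation ((*v) (rho_v g))"
    using g by (intro orthogonal_transformation_rho_v) (auto simp: spatial_group_carrier_iff graph_automorphism_def)
  have H: "subspace ?H" "?H \<subseteq> ?K"
    using rigid_velocity_in_kernel[OF F]
    by (auto simp: H_rig_eq[OF F] linear_subspace_image[OF linear_rigid_velocity])
  note inv = H_rig_invariant[OF F g]
  have "?R *v (rho_v g *v w) = rho_e ends g *v (?R *v w)" for w
    using rigidity_matrix_equivariant[OF F g] by (simp add: matrix_vector_mul_assoc)
  then have "(*v) (rho_v g) ` ?K \<subseteq> ?K"
    by auto
  moreover have "(*v) (rho_v g) ` (?H\<^sup>\<bottom>) \<subseteq> ?H\<^sup>\<bottom>"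
    by (rule orthogonal_transformation_invariant_comp[OF orth H(1) inv])
  ultimately have "trace_on ?K ((*v) (rho_v g)) = trace_on ?H ((*v) (rho_v g)) + trace_on (?K \<inter> ?H\<^sup>\<bottom>) ((*v) (rho_v g))"
    using H inv by (intro trace_on_orthogonal_split) (auto simp: subspace_kernel)
  then show ?thesis
    by (simp add: chi_mech_def chi_rig_def H_mech_def)
qed

lemma character_formula:
  assumes F: "point_line_framework ends P L" and g: "g \<in> carrier (spatial_group ends P L)"
  shows "chi_mech ends P L g - chi_st ends P L g
     = trace (rho_n g) * trace (rho_sp g) - trace (rho_e ends g) - chi_rig P L g"
proof -
  have "orthogonal_transformation ((*v) (rho_v g))" "orthogonal_transformation ((*v) (rho_e ends g))"
    using g F by (auto intro!: orthogonal_transformation_rho_v orthogonal_transformation_rho_e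
        simp: spatial_group_carrier_iff graph_automorphism_def point_line_framework_def)
  then show ?thesis
    using trace_ker_minus_coker[OF rigidity_matrix_equivariant[OF F g]]
    by (simp add: chi_mech_eq[OF F g] chi_st_def H_st_def trace_rho_v del: transpose_matrix_vector)
qed

lemma reflection_trace_det:
  assumes "is_reflection T"
  shows "trace T = 0" "det T = -1"
proof -
  obtain n :: "real^2" where n: "n \<noteq> 0" "\<And>z. T *v z = z - (2 * (z \<bullet> n) / (n \<bullet> n)) *\<^sub>R n"
    using assms by (auto simp: is_reflection_def)
  define N where "N = n \<bullet> n"
  have N: "N \<noteq> 0" "N = n $ 1 * n $ 1 + n $ 2 * n $ 2"
    using n(1) by (simp add: N_def) (simp add: N_def inner_vec_def sum_2)
  have T: "T $ i $ j = (if i = j then 1 else 0) - 2 * n $ j * n $ i / N" for i j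
  proof -
    have "T $ i $ j = (T *v axis j 1) $ i"
      by (simp add: matrix_vector_mult_basis column_def)
    then show ?thesis
      unfolding n(2) by (simp add: inner_axis' N_def) (simp add: axis_def)
  qed
  show "trace T = 0"
    using N by (simp add: trace_def sum_2 T field_simps)
  show "det T = -1"
  proof -
    have "det T = 1 - 2 * (n $ 1 * n $ 1 + n $ 2 * n $ 2) / N"
      using N(1) by (simp add: det_2 T field_simps)
    also have "\<dots> = 1 - 2 * N / N"
      by (simp only: N(2)[symmetric])
    finally show ?thesis
      using N(1) by simp
  qed
qed

lemma card_edges_by_type:
  fixes ends :: "'e::finite \<Rightarrow> ('p::finite + 'l::finite) set"
  assumes "simple_graph ends"
  shows "card (pp_edges ends \<inter> X) + card (ll_edges ends \<inter> X) + card (pl_edges ends \<inter> X) = card X"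
proof -
  let ?A = "pp_edges ends" and ?B = "ll_edges ends" and ?C = "pl_edges ends"
  have "e \<in> ?A \<union> ?B \<union> ?C" for e
  proof -
    obtain u v where "ends e = {u, v}"
      using simple_graph_ends[OF assms] by metis
    then show ?thesis
      by (cases u; cases v) (auto simp: pp_edges_def ll_edges_def pl_edges_def insert_commute)
  qed
  then have X: "X = (?A \<inter> X) \<union> (?B \<inter> X) \<union> (?C \<inter> X)"
    by blast
  have "ends e \<noteq> {}" for e
    using simple_graph_ends[OF assms] by (metis insert_not_empty)
  then have "?A \<inter> ?B = {}"
    by (auto simp: pp_edges_def ll_edges_def)
  moreover have "?A \<inter> ?C = {}" "?B \<inter> ?C = {}"
    by (auto simp: pp_edges_def ll_edges_def pl_edges_def)
  ultimately have "(?A \<inter> X) \<inter> (?B \<inter> X) = {}" "(?A \<inter> X \<union> ?B \<inter> X) \<inter> (?C \<inter> X) = {}"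
    by blast+
  then have "card (?A \<inter> X \<union> ?B \<inter> X) = card (?A \<inter> X) + card (?B \<inter> X)"
    and "card (?A \<inter> X \<union> ?B \<inter> X \<union> ?C \<inter> X) = card (?A \<inter> X \<union> ?B \<inter> X) + card (?C \<inter> X)"
    by (simp_all only: card_Un_disjoint finite)
  then show ?thesis
    using X by simp
qed

theorem theorem4p1:
  fixes ends :: "'e::finite \<Rightarrow> ('p::finite + 'l::finite) set"
    and P :: "'p \<Rightarrow> real^2"
    and L :: "'l \<Rightarrow> (real^2) set"
  assumes "point_line_framework ends P L"
  shows
    "(\<forall>g\<in>carrier (spatial_group ends P L).
        rigidity_matrix ends P L =
          rho_e ends (inv\<^bsub>spatial_group ends P L\<^esub> g) ** rigidity_matrix ends P L ** rho_v g) \<and>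
     (\<forall>g\<in>carrier (spatial_group ends P L).
        chi_mech ends P L g - chi_st ends P L g =
          trace (rho_n g) * trace (rho_sp g) - trace (rho_e ends g) - chi_rig P L g) \<and>
     (isostatic ends P L \<longrightarrow>
       (\<forall>g\<in>carrier (spatial_group ends P L). is_reflection (snd g) \<and> fst g \<noteq> id \<longrightarrow>
          int (card (pp_edges ends \<inter> unchanged ends g))
            + int (card (ll_edges ends \<inter> unchanged ends g))
            + int (card (pl_edges ends \<inter> unchanged ends g)) - 1 = 0))"
proof (intro conjI ballI impI)
  let ?G = "spatial_group ends P L" and ?R = "rigidity_matrix ends P L"
  have S: "simple_graph ends"
    using assms by (simp add: point_line_framework_def)
  interpret group ?G
    by (rule group_spatial_group)
  fix g assume g: "g \<in> carrier ?G"
  show "?R = rho_e ends (inv\<^bsub>?G\<^esub> g) ** ?R ** rho_v g"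
  proof -
    have "inv\<^bsub>?G\<^esub> g \<otimes>\<^bsub>?G\<^esub> g = \<one>\<^bsub>?G\<^esub>"
      using g by (rule l_inv)
    then have "fst (inv\<^bsub>?G\<^esub> g) \<circ> fst g = id"
      by (simp add: spatial_group_def)
    moreover have "graph_automorphism ends (fst g)" "graph_automorphism ends (fst (inv\<^bsub>?G\<^esub> g))"
      using g inv_closed[OF g] by (simp_all add: spatial_group_carrier_iff)
    ultimately have "rho_e ends (inv\<^bsub>?G\<^esub> g) ** rho_e ends g = mat 1"
      by (intro rho_e_inverse S)
    then show ?thesis
      by (simp add: rigidity_matrix_equivariant[OF assms g, symmetric] matrix_mul_assoc[symmetric])
        (simp add: matrix_mul_assoc)
  qed
  show "chi_mech ends P L g - chi_st ends P L g
      = trace (rho_n g) * trace (rho_sp g) - trace (rho_e ends g) - chi_rig P L g"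
    by (rule character_formula[OF assms g])
  assume iso: "isostatic ends P L" and refl: "is_reflection (snd g) \<and> fst g \<noteq> id"
  have "chi_mech ends P L g = 0" "chi_st ends P L g = 0"
    using iso by (simp_all add: chi_mech_def chi_st_def isostatic_def trace_on_zero)
  moreover have "chi_rig P L g = -1" "trace (rho_sp g) = 0"
    using chi_rig_eq[OF assms g] reflection_trace_det refl by (auto simp: rho_sp_def)
  ultimately have "trace (rho_e ends g) = 1"
    using character_formula[OF assms g] by simp
  then have "card (unchanged ends g) = 1"
    by (simp add: trace_rho_e)
  then show "int (card (pp_edges ends \<inter> unchanged ends g)) + int (card (ll_edges ends \<inter> unchanged ends g))
      + int (card (pl_edges ends \<inter> unchanged ends g)) - 1 = 0"
    using card_edges_by_type[OF S, of "unchanged ends g"] by linarith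
qed

end
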